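(* Let $p,q$ be distinct odd primes and $\alpha,\beta$ positive integers. Then $$\sum_{\substack{i+j+k=p^{\alpha}q^{\beta}\\ i,j,k\in\mathcal{P}_{pq}\\ i\equiv j\equiv k\equiv 1 \pmod 2}}\frac{1}{ijk}\equiv\frac{7}{16}Z(p^{\alpha}q^{\beta})\equiv \frac{7}{8}(2-q)\Bigl(1-\frac{1}{q^{3}}\Bigr)p^{\alpha-1}q^{\beta-1}B_{p-3}\pmod{p^{\alpha}}.$$
   Context: For a positive integer $n$, $\mathcal{P}_n$ denotes the set of positive integers coprime to $n$, and $Z(n)=\sum_{i+j+k=n,\ i,j,k\in\mathcal{P}_n}\frac{1}{ijk}$. All sums are over ordered triples $(i,j,k)$ of positive integers. The Bernoulli numbers $B_k$ are defined by $B_0=1$ and $\sum_{i=0}^{n}\binom{n+1}{i}B_i=0$ for $n\ge1$. A congruence between rational numbers modulo $p^{\alpha}$ means that the difference, written in lowest terms, has numerator divisible by $p^{\alpha}$ and denominator coprime to $p$. *)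

theory Defs
  imports Complex_Main "HOL-Computational_Algebra.Primes"
begin

definition coprime_pos :: "nat \<Rightarrow> nat set" where
  "coprime_pos n = {m. 0 < m \<and> coprime m n}"

definition Z :: "nat \<Rightarrow> rat" where
  "Z n = (\<Sum>(i, j, k) \<in> {(i, j, k). i \<in> coprime_pos n \<and> j \<in> coprime_pos n \<and> k \<in> coprime_pos n
            \<and> i + j + k = n}. 1 / (of_nat i * of_nat j * of_nat k))"

text \<open>
  The Bernoulli numbers, with the convention \<open>B\<^sub>1 = - 1/2\<close>.  The recursion is the relation
  \<open>bernoulli_recurrence\<close> below, solved for its last summand.
\<close>

fun bernoulli :: "nat \<Rightarrow> rat" where
  "bernoulli 0 = 1"
| "bernoulli (Suc n) =
     - (\<Sum>i\<le>n. of_nat (Suc (Suc n) choose i) * bernoulli i) / of_nat (Suc (Suc n))"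

lemma bernoulli_recurrence:
  assumes "n \<ge> 1"
  shows "(\<Sum>i\<le>n. of_nat ((n + 1) choose i) * bernoulli i) = 0"
proof -
  obtain m where n: "n = Suc m"
    using assms by (cases n) auto
  have "(\<Sum>i\<le>n. of_nat ((n + 1) choose i) * bernoulli i) =
        (\<Sum>i\<le>m. of_nat (Suc (Suc m) choose i) * bernoulli i)
          + of_nat (Suc (Suc m) choose Suc m) * bernoulli (Suc m)"
    unfolding n by (simp del: bernoulli.simps binomial_Suc_Suc)
  also have "Suc (Suc m) choose Suc m = Suc (Suc m)"
    by (rule binomial_Suc_n)
  also have "of_nat (Suc (Suc m)) * bernoulli (Suc m) =
      - (\<Sum>i\<le>m. of_nat (Suc (Suc m) choose i) * bernoulli i)"
    unfolding bernoulli.simps(2) by (simp del: of_nat_Suc binomial_Suc_Suc)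
  finally show ?thesis
    by simp
qed

text \<open>
  Congruence of rationals modulo \<open>p ^ a\<close>; \<^const>\<open>quotient_of\<close> returns the numerator and the
  (positive) denominator in lowest terms.
\<close>

definition rat_cong :: "nat \<Rightarrow> nat \<Rightarrow> rat \<Rightarrow> rat \<Rightarrow> bool" where
  "rat_cong p a x y \<longleftrightarrow>
     int p ^ a dvd fst (quotient_of (x - y)) \<and> coprime (snd (quotient_of (x - y))) (int p)"

end

theory Submission
  imports Defs "HOL-Number_Theory.Residues"
begin

text \<open>
  Modulo \<open>p ^ a\<close> the function \<open>x \<mapsto> 1 / x\<close> is odd and periodic with any period \<open>n\<close>
  divisible by \<open>p ^ a\<close>.  Writing \<open>i = x + n b\<close> with \<open>x < n\<close> therefore reduces a sum over
  triples of total \<open>t n\<close> to residue triples of total \<open>n\<close> or \<open>2 n\<close>, and the latter are the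
  negatives of the former.  With \<open>t = 2\<close> and parity weights this gives the factor \<open>7 / 16\<close>;
  with weight one it removes the powers of \<open>q\<close>, and, expanding \<open>1 / (x + n b)\<close> to first order,
  the powers of \<open>p\<close>.  There remains the sum for \<open>p q\<close> modulo \<open>p\<close>, where inclusion-exclusion
  over divisibility by \<open>q\<close> leads to the triples with \<open>q dvd i\<close>.  Partial fractions express their
  sum by \<open>X = (\<Sum>j<r<p. 1 / (j r\<^sup>2))\<close>, which Faulhaber's formula identifies with \<open>B\<^bsub>p-3\<^esub>\<close>,
  and by \<open>V = (\<Sum>m<p. (q m div p) / (q m) ^ 3)\<close>, which is given by Voronoi's congruence.
\<close>

subsection \<open>Congruences between rational numbers\<close>

text \<open>The evaluation at total \<open>p q\<close> is known only modulo \<open>p\<close>,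
  whereas the claim is modulo \<open>p ^ \<alpha>\<close>. The gap closes because passing from total
  \<open>n\<close> to total \<open>p n\<close> multiplies the sum by \<open>p\<close> to one power
  of \<open>p\<close> more than periodicity alone gives; this is what the first-order expansion is
  for, and its correction term has to be shown to vanish. The prime \<open>p = 3\<close> is
  included, so \<open>3\<close> must never be inverted without care. The sum \<open>V\<close> is
  therefore determined only through \<open>3 V\<close>, which is exactly what occurs, since the
  multiple of \<open>q\<close> can stand in three positions. Origin of the constants:
  \<open>q\<close> divides the total, so two entries divisible by \<open>q\<close> force the third.
  With \<open>B\<close> the Bernoulli number, all triples prime to \<open>p\<close> contribute
  \<open>- 2 q B\<close>, those with a prescribed entry divisible by \<open>q\<close> contribute
  \<open>- 2 B + 2 V\<close>, and those with all entries divisible by \<open>q\<close> contribute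
  \<open>- 2 B / q ^ 3\<close>. Weighted by \<open>1\<close>, \<open>- 3\<close> and
  \<open>2\<close>, and with \<open>3 V \<equiv> (1 - 1 / q ^ 2) B\<close>, they add up to
  \<open>2 (2 - q) (1 - 1 / q ^ 3) B\<close>; the factor \<open>7 / 8\<close> is
  \<open>7 / 16\<close> times this \<open>2\<close>.\<close>

definition p_integral :: "nat \<Rightarrow> rat \<Rightarrow> bool" where
  "p_integral p x \<longleftrightarrow> (\<exists>a b::int. \<not> int p dvd b \<and> x = of_int a / of_int b)"

text \<open>Neither side has to be \<open>p\<close>-integral, only the scaled difference:
  congruences can be added freely, while the product rules carry integrality hypotheses.\<close>

definition pcong :: "nat \<Rightarrow> nat \<Rightarrow> rat \<Rightarrow> rat \<Rightarrow> bool" where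
  "pcong p a x y \<longleftrightarrow> p_integral p ((x - y) / of_nat p ^ a)"

lemma p_integral_of_int [simp]: "prime p \<Longrightarrow> p_integral p (of_int a)"
  unfolding p_integral_def
  by (rule exI[of _ a], rule exI[of _ 1]) (auto dest: not_prime_unit)

lemma p_integral_of_nat [simp]: "prime p \<Longrightarrow> p_integral p (of_nat a)"
  using p_integral_of_int[of p "int a"] by simp

lemma p_integral_0 [simp]: "prime p \<Longrightarrow> p_integral p 0"
  using p_integral_of_int[of p 0] by simp

lemma p_integral_1 [simp]: "prime p \<Longrightarrow> p_integral p 1"
  using p_integral_of_int[of p 1] by simp

lemma p_integral_numeral [simp]: "prime p \<Longrightarrow> p_integral p (numeral k)"
  using p_integral_of_int[of p "numeral k"] by simp

lemma p_integral_add [intro]: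
  assumes "prime p" "p_integral p x" "p_integral p y"
  shows "p_integral p (x + y)"
proof -
  obtain a b c d where x: "\<not> int p dvd b" "x = of_int a / of_int b"
    and y: "\<not> int p dvd d" "y = of_int c / of_int d"
    using assms unfolding p_integral_def by metis
  have "\<not> int p dvd b * d"
    using x y assms(1) by (simp add: prime_dvd_mult_iff)
  moreover have "x + y = of_int (a * d + c * b) / of_int (b * d)"
    using x y by (subst x(2), subst y(2), subst add_frac_eq) auto
  ultimately show ?thesis
    unfolding p_integral_def by blast
qed

lemma p_integral_mult [intro]:
  assumes "prime p" "p_integral p x" "p_integral p y"
  shows "p_integral p (x * y)"
proof -
  obtain a b c d where x: "\<not> int p dvd b" "x = of_int a / of_int b"
    and y: "\<not> int p dvd d" "y = of_int c / of_int d"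
    using assms unfolding p_integral_def by metis
  have "\<not> int p dvd b * d"
    using x y assms(1) by (simp add: prime_dvd_mult_iff)
  moreover have "x * y = of_int (a * c) / of_int (b * d)"
    using x y by simp
  ultimately show ?thesis
    unfolding p_integral_def by blast
qed

lemma p_integral_minus [intro]: "p_integral p x \<Longrightarrow> p_integral p (- x)"
  unfolding p_integral_def by (metis minus_divide_left of_int_minus)

lemma p_integral_diff [intro]:
  "prime p \<Longrightarrow> p_integral p x \<Longrightarrow> p_integral p y \<Longrightarrow> p_integral p (x - y)"
  using p_integral_add[of p x "- y"] by auto

lemma p_integral_power [intro]: "prime p \<Longrightarrow> p_integral p x \<Longrightarrow> p_integral p (x ^ k)"
  by (induction k) auto

lemma p_integral_sum [intro]:
  "prime p \<Longrightarrow> (\<And>i. i \<in> A \<Longrightarrow> p_integral p (f i)) \<Longrightarrow> p_integral p (sum f A)"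
  by (induction A rule: infinite_finite_induct) auto

lemma p_integral_inverse:
  assumes "\<not> p dvd m"
  shows "p_integral p (1 / of_nat m)"
  unfolding p_integral_def
  by (rule exI[of _ 1], rule exI[of _ "int m"]) (use assms in auto)

lemma p_integral_divide:
  assumes "prime p" "p_integral p x" "\<not> p dvd m"
  shows "p_integral p (x / of_nat m)"
  using p_integral_mult[OF assms(1,2) p_integral_inverse[OF assms(3)]] by simp

lemma pcong_refl [simp]: "prime p \<Longrightarrow> pcong p a x x"
  by (simp add: pcong_def)

lemma pcong_sym: "pcong p a x y \<Longrightarrow> pcong p a y x"
  unfolding pcong_def by (drule p_integral_minus) (simp add: minus_divide_left)

lemma pcong_trans [trans]:
  assumes "pcong p a x y" "pcong p a y z" "prime p"
  shows "pcong p a x z"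
  using p_integral_add[OF assms(3) assms(1,2)[unfolded pcong_def]]
  by (simp add: pcong_def flip: add_divide_distrib)

lemma pcong_add:
  "prime p \<Longrightarrow> pcong p a x y \<Longrightarrow> pcong p a u v \<Longrightarrow> pcong p a (x + u) (y + v)"
  unfolding pcong_def
  by (drule (2) p_integral_add) (simp add: algebra_simps flip: add_divide_distrib)

lemma pcong_minus: "pcong p a x y \<Longrightarrow> pcong p a (- x) (- y)"
  unfolding pcong_def by (drule p_integral_minus) (simp add: minus_divide_left)

lemma pcong_diff:
  "prime p \<Longrightarrow> pcong p a x y \<Longrightarrow> pcong p a u v \<Longrightarrow> pcong p a (x - u) (y - v)"
  using pcong_add[of p a x y "- u" "- v"] pcong_minus[of p a u v] by simp

lemma pcong_scale:
  assumes "prime p" "p_integral p c" "pcong p a x y"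
  shows "pcong p a (c * x) (c * y)"
  using p_integral_mult[OF assms(1,2) assms(3)[unfolded pcong_def]]
  by (simp add: pcong_def right_diff_distrib)

lemma pcong_mult:
  assumes "prime p" "p_integral p x" "p_integral p v" "pcong p a x y" "pcong p a u v"
  shows "pcong p a (x * u) (y * v)"
  using pcong_trans[OF pcong_scale[OF assms(1,2,5)]
      pcong_scale[OF assms(1,3,4), unfolded mult.commute[of v]] assms(1)] .

lemma pcong_sum:
  "prime p \<Longrightarrow> (\<And>i. i \<in> A \<Longrightarrow> pcong p a (f i) (g i)) \<Longrightarrow> pcong p a (sum f A) (sum g A)"
  by (induction A rule: infinite_finite_induct) (auto intro: pcong_add)

lemma pcong_mult_zero:
  assumes "prime p" "pcong p a x 0" "pcong p b y 0"
  shows "pcong p (a + b) (x * y) 0"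
  using p_integral_mult[OF assms(1) assms(2,3)[unfolded pcong_def]]
  by (simp add: pcong_def power_add)

lemma pcong_p_power:
  assumes "prime p" "pcong p a x y"
  shows "pcong p (a + b) (of_nat p ^ b * x) (of_nat p ^ b * y)"
  using assms unfolding pcong_def by (simp add: power_add flip: right_diff_distrib)

lemma p_integral_pcong:
  assumes "prime p" "pcong p a x y" "p_integral p y"
  shows "p_integral p x"
proof -
  have "x = of_nat p ^ a * ((x - y) / of_nat p ^ a) + y"
    using assms(1) by (simp add: prime_gt_0_nat)
  then show ?thesis
    using assms by (metis p_integral_add p_integral_mult p_integral_power p_integral_of_nat
        pcong_def)
qed

lemma pcong_zero_iff: "pcong p a x y \<longleftrightarrow> pcong p a (x - y) 0"
  by (simp add: pcong_def)

lemma pcong_weaken: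
  assumes "prime p" "pcong p b x y" "a \<le> b"
  shows "pcong p a x y"
proof -
  have "(x - y) / of_nat p ^ a = of_nat p ^ (b - a) * ((x - y) / of_nat p ^ b)"
    using assms(1,3) by (simp add: power_diff prime_gt_0_nat)
  then show ?thesis
    using p_integral_mult[OF assms(1), of "of_nat p ^ (b - a)" "(x - y) / of_nat p ^ b"] assms
    unfolding pcong_def by (metis p_integral_of_nat p_integral_power)
qed

lemma pcong_of_int_zero:
  assumes "prime p" "int p ^ a dvd m"
  shows "pcong p a (of_int m) 0"
proof -
  obtain c where "m = int p ^ a * c"
    using assms(2) by blast
  then have "of_int m / of_nat p ^ a = (of_int c :: rat)"
    using assms(1) by (simp add: prime_gt_0_nat)
  then show ?thesis
    using assms(1) by (simp add: pcong_def)
qed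

lemma pcong_of_nat_zero: "prime p \<Longrightarrow> p ^ a dvd m \<Longrightarrow> pcong p a (of_nat m) 0"
  using pcong_of_int_zero[of p a "int m"] by (simp flip: of_nat_power)

lemma pcong_of_nat:
  assumes "prime p" "[m = k] (mod p ^ a)"
  shows "pcong p a (of_nat m) (of_nat k)"
proof -
  have "int p ^ a dvd int m - int k"
    using assms(2) by (metis cong_iff_dvd_diff cong_int_iff of_nat_power)
  from pcong_of_int_zero[OF assms(1) this] show ?thesis
    by (simp add: pcong_zero_iff[of p a "of_nat m"])
qed

lemma pcong_inverse:
  assumes "prime p" "pcong p a (of_nat m) (of_nat k)" "\<not> p dvd m" "\<not> p dvd k"
  shows "pcong p a (1 / of_nat m) (1 / of_nat k)"
proof -
  have eq: "m \<noteq> 0" "k \<noteq> 0"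
    using assms by (metis dvd_0_right)+
  \<comment> \<open>Multiplication by \<open>1 / (m k)\<close> turns the congruence of
    \<open>k\<close> and \<open>m\<close> into that of \<open>1 / m\<close> and
    \<open>1 / k\<close>.\<close>
  have "pcong p a (1 / of_nat m * (1 / of_nat k) * of_nat k)
      (1 / of_nat m * (1 / of_nat k) * of_nat m)"
    by (intro pcong_scale pcong_sym[OF assms(2)] p_integral_mult p_integral_inverse assms)
  then show ?thesis
    using eq by simp
qed

text \<open>With \<open>(x - y) / p ^ a = c / d\<close> and \<open>x - y = u / v\<close> in lowest
  terms, \<open>u d = c p ^ a v\<close>. Since \<open>p\<close> does not divide \<open>d\<close>,
  the power \<open>p ^ a\<close> divides \<open>u\<close>; since \<open>u\<close> and
  \<open>v\<close> are coprime, \<open>v\<close> divides \<open>d\<close> and inherits its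
  coprimality to \<open>p\<close>.\<close>

lemma rat_congI:
  assumes "prime p" "pcong p a x y"
  shows "rat_cong p a x y"
proof -
  obtain c d where cd: "\<not> int p dvd d" "(x - y) / of_nat p ^ a = of_int c / of_int d"
    using assms unfolding pcong_def p_integral_def by blast
  obtain u v where uv: "quotient_of (x - y) = (u, v)"
    by fastforce
  then have v: "v > 0" "coprime u v" "x - y = of_int u / of_int v"
    by (auto intro: quotient_of_denom_pos quotient_of_coprime quotient_of_div)
  have d0: "d \<noteq> 0"
    using cd by auto
  have p0: "p > 0"
    using assms(1) by (simp add: prime_gt_0_nat)
  have "of_int (u * d) = (of_int (c * int p ^ a * v) :: rat)"
    using cd(2) v d0 p0 by (simp add: field_simps)
  then have e: "u * d = c * int p ^ a * v"
    by (simp only: of_int_eq_iff)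
  have cop: "coprime d (int p)"
    using cd(1) assms(1) by (metis coprime_commute prime_imp_coprime prime_nat_int_transfer)
  have "int p ^ a dvd u * d"
    using e by simp
  then have 1: "int p ^ a dvd u"
    using cop by (simp add: coprime_dvd_mult_left_iff coprime_commute)
  have "v dvd u * d"
    using e by simp
  then have "v dvd d"
    using v(2) by (simp add: coprime_dvd_mult_right_iff coprime_commute)
  then have "coprime v (int p)"
    using cop by (metis coprime_divisors dvd_refl)
  then show ?thesis
    unfolding rat_cong_def uv using 1 by simp
qed

subsection \<open>Reduction to residue triples\<close>

text \<open>The domain is a parameter so that one notion covers both unrestricted entries,
  \<open>coprime_pos m\<close>, and reduced residues,
  \<open>coprime_pos m \<inter> {..<n}\<close>.\<close>

definition triples :: "nat set \<Rightarrow> nat \<Rightarrow> (nat \<times> nat \<times> nat) set" where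
  "triples D n = {(i, j, k). i \<in> D \<and> j \<in> D \<and> k \<in> D \<and> i + j + k = n}"

definition recip3 :: "nat \<times> nat \<times> nat \<Rightarrow> rat" where
  "recip3 = (\<lambda>(i, j, k). 1 / (of_nat i * of_nat j * of_nat k))"

definition translate :: "nat \<Rightarrow> nat \<times> nat \<times> nat \<Rightarrow> nat \<times> nat \<times> nat \<Rightarrow> nat \<times> nat \<times> nat" where
  "translate n = (\<lambda>(x, y, z) (a, b, c). (x + n * a, y + n * b, z + n * c))"

definition reflect :: "nat \<Rightarrow> nat \<times> nat \<times> nat \<Rightarrow> nat \<times> nat \<times> nat" where
  "reflect n = (\<lambda>(x, y, z). (n - x, n - y, n - z))"

lemma finite_triples [simp]: "finite (triples D n)"
proof -
  have "triples D n \<subseteq> {..n} \<times> {..n} \<times> {..n}"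
    by (auto simp: triples_def)
  then show ?thesis
    using finite_subset by blast
qed

lemma coprime_pos_add_multiple:
  assumes "m dvd n" "x > 0"
  shows "x + n * a \<in> coprime_pos m \<longleftrightarrow> x \<in> coprime_pos m"
proof -
  obtain c where "n = m * c"
    using assms(1) by blast
  then have "gcd (x + n * a) m = gcd x m"
    by (metis gcd.commute gcd_add_mult add.commute mult.assoc mult.commute)
  then show ?thesis
    using assms(2) by (simp add: coprime_pos_def coprime_iff_gcd_eq_1)
qed

lemma coprime_pos_complement:
  assumes "m dvd n" "x \<in> coprime_pos m" "x < n"
  shows "n - x \<in> coprime_pos m"
proof -
  have "coprime x m"
    using assms(2) by (simp add: coprime_pos_def)
  have "coprime (n - x) m"
  proof (rule coprimeI)
    fix c assume "c dvd n - x" "c dvd m"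
    then have "c dvd x"
      using assms(1,3) by (metis dvd_diffD1 dvd_trans less_imp_le)
    with \<open>c dvd m\<close> show "is_unit c"
      using \<open>coprime x m\<close> coprime_common_divisor by blast
  qed
  then show ?thesis
    using assms(3) by (simp add: coprime_pos_def)
qed

lemma coprime_pos_mod:
  assumes "m dvd n" "1 < m" "x \<in> coprime_pos m"
  shows "0 < x mod n" "x mod n \<in> coprime_pos m"
proof -
  show pos: "0 < x mod n"
  proof (rule ccontr)
    assume "\<not> 0 < x mod n"
    then have "m dvd x"
      using assms(1) by (meson dvd_trans mod_greater_zero_iff_not_dvd)
    then show False
      using assms(2,3) by (auto simp: coprime_pos_def coprime_absorb_right)
  qed
  show "x mod n \<in> coprime_pos m"
    using coprime_pos_add_multiple[OF assms(1) pos, of "x div n"] assms(3) by simp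
qed

text \<open>The residues modulo \<open>n\<close> of a triple of total \<open>t n\<close> again have
  a total divisible by \<open>n\<close>. They are positive, because \<open>m > 1\<close> divides
  \<open>n\<close>, and less than \<open>n\<close>, so this total is \<open>s n\<close> with
  \<open>s = 1\<close> or \<open>s = 2\<close>, and the quotients add up to \<open>t - s\<close>.
  Writing \<open>a + b + c + s = t\<close> avoids truncated subtraction: the index set is empty when
  \<open>s > t\<close>.\<close>

lemma sum_triples_blocks:
  fixes F :: "nat \<times> nat \<times> nat \<Rightarrow> rat"
  assumes "n > 0" "m dvd n" "1 < m"
  shows "sum F (triples (coprime_pos m) (t * n)) =
    (\<Sum>s\<in>{1, 2}. \<Sum>T\<in>triples (coprime_pos m \<inter> {..<n}) (s * n).
        \<Sum>A\<in>{(a, b, c). a + b + c + s = t}. F (translate n T A))"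
proof -
  let ?R = "\<lambda>s. triples (coprime_pos m \<inter> {..<n}) (s * n)"
  let ?L = "\<lambda>s. {(a, b, c). a + b + c + s = t}"
  have finL: "finite (?L s)" for s
    by (rule finite_subset[of _ "{..t} \<times> {..t} \<times> {..t}"]) auto
  have "(\<Sum>s\<in>{1, 2}. \<Sum>T\<in>?R s. \<Sum>A\<in>?L s. F (translate n T A)) =
      (\<Sum>(s, T, A)\<in>(SIGMA s:{1, 2}. ?R s \<times> ?L s). F (translate n T A))"
    unfolding sum.cartesian_product by (subst sum.Sigma) (simp_all add: finL)
  also have "\<dots> = sum F (triples (coprime_pos m) (t * n))"
  proof (rule sum.reindex_bij_witness[symmetric,
        where i = "\<lambda>(s, T, A). translate n T A"
          and j = "\<lambda>(i, j, k). ((i mod n + j mod n + k mod n) div n,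
                 (i mod n, j mod n, k mod n), (i div n, j div n, k div n))"])
    fix T assume T: "T \<in> triples (coprime_pos m) (t * n)"
    obtain i j k where [simp]: "T = (i, j, k)"
      by (cases T)
    have ijk: "i \<in> coprime_pos m" "j \<in> coprime_pos m" "k \<in> coprime_pos m"
      and sum: "i + j + k = t * n"
      using T by (auto simp: triples_def)
    define r d where "r = i mod n + j mod n + k mod n" and "d = i div n + j div n + k div n"
    have "n * d + r = i + j + k"
      unfolding r_def d_def distrib_left
      using mult_div_mod_eq[of n i] mult_div_mod_eq[of n j] mult_div_mod_eq[of n k] by linarith
    then have e: "n * d + r = t * n"
      using sum by simp
    then have "n dvd n * d + r"
      by simp
    then have "n dvd r"
      using dvd_add_right_iff[of n "n * d" r] by simp
    then obtain s where "r = n * s"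
      by blast
    then have s: "i mod n + j mod n + k mod n = s * n" and r: "r = s * n"
      by (simp_all add: r_def mult.commute)
    have "i mod n < n" "j mod n < n" "k mod n < n"
      using assms(1) by auto
    then have "s * n < 3 * n" "s * n > 0"
      using s coprime_pos_mod(1)[OF assms(2,3) ijk(1)] by linarith+
    then have s12: "s \<in> {1, 2}"
      by auto
    have "(d + s) * n = t * n"
      using e r by (simp add: algebra_simps)
    then have "i div n + j div n + k div n + s = t"
      using assms(1) by (simp add: d_def)
    then show "(case T of (i, j, k) \<Rightarrow> ((i mod n + j mod n + k mod n) div n,
                 (i mod n, j mod n, k mod n), (i div n, j div n, k div n)))
        \<in> (SIGMA s:{1, 2}. ?R s \<times> ?L s)"
      using s12 coprime_pos_mod(2)[OF assms(2,3)] ijk assms(1)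
      by (simp add: triples_def s)
    show "(case (case T of (i, j, k) \<Rightarrow> ((i mod n + j mod n + k mod n) div n,
                 (i mod n, j mod n, k mod n), (i div n, j div n, k div n)))
        of (s, T, A) \<Rightarrow> translate n T A) = T"
      by (simp add: translate_def)
    show "(case (case T of (i, j, k) \<Rightarrow> ((i mod n + j mod n + k mod n) div n,
                 (i mod n, j mod n, k mod n), (i div n, j div n, k div n)))
        of (s, T, A) \<Rightarrow> F (translate n T A)) = F T"
      by (simp add: translate_def)
  next
    fix u assume u: "u \<in> (SIGMA s:{1, 2}. ?R s \<times> ?L s)"
    obtain s x y z a b c where [simp]: "u = (s, (x, y, z), (a, b, c))"
      by (cases u) auto
    have xyz: "x \<in> coprime_pos m" "y \<in> coprime_pos m" "z \<in> coprime_pos m"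
      "x < n" "y < n" "z < n" "x + y + z = s * n" "a + b + c + s = t"
      using u by (auto simp: triples_def)
    then have pos: "x > 0" "y > 0" "z > 0"
      by (auto simp: coprime_pos_def)
    have "(x + n * a) + (y + n * b) + (z + n * c) = (a + b + c) * n + (x + y + z)"
      by (simp add: algebra_simps)
    also have "\<dots> = t * n"
      using xyz(7,8) by (simp flip: add_mult_distrib)
    finally show "(case u of (s, T, A) \<Rightarrow> translate n T A) \<in> triples (coprime_pos m) (t * n)"
      using xyz pos by (simp add: translate_def triples_def coprime_pos_add_multiple[OF assms(2)])
    show "(case (case u of (s, T, A) \<Rightarrow> translate n T A) of (i, j, k) \<Rightarrow>
        ((i mod n + j mod n + k mod n) div n,
           (i mod n, j mod n, k mod n), (i div n, j div n, k div n))) = u"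
      using xyz assms(1) by (simp add: translate_def)
  qed
  finally show ?thesis
    by simp
qed

lemma triples_less: "triples (coprime_pos m \<inter> {..<n}) n = triples (coprime_pos m) n"
  by (auto simp: triples_def coprime_pos_def)

lemma reflect_triples:
  assumes "m dvd n" "T \<in> triples (coprime_pos m) n"
  shows "reflect n T \<in> triples (coprime_pos m \<inter> {..<n}) (2 * n)"
proof -
  obtain x y z where T: "T = (x, y, z)"
    by (cases T)
  have "x \<in> coprime_pos m" "y \<in> coprime_pos m" "z \<in> coprime_pos m" and n: "x + y + z = n"
    using assms(2) by (auto simp: T triples_def)
  moreover from this have "x > 0" "y > 0" "z > 0"
    by (auto simp: coprime_pos_def)
  moreover from this n have "x < n" "y < n" "z < n"
    by linarith+
  ultimately show ?thesis
    using coprime_pos_complement[OF assms(1)] by (auto simp: T triples_def reflect_def)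
qed

text \<open>Reflection is an involution that exchanges the totals \<open>n\<close> and
  \<open>3 n - n = 2 n\<close>. The bound on the entries keeps the subtraction exact.\<close>

lemma sum_triples_reflect:
  fixes F :: "nat \<times> nat \<times> nat \<Rightarrow> rat"
  assumes "m dvd n"
  shows "sum F (triples (coprime_pos m \<inter> {..<n}) (2 * n)) =
    (\<Sum>T\<in>triples (coprime_pos m) n. F (reflect n T))"
proof (rule sum.reindex_bij_witness[where i = "reflect n" and j = "reflect n"])
  fix T assume T: "T \<in> triples (coprime_pos m \<inter> {..<n}) (2 * n)"
  then show "reflect n (reflect n T) = T"
    by (auto simp: triples_def reflect_def)
  then show "F (reflect n (reflect n T)) = F T"
    by simp
  show "reflect n T \<in> triples (coprime_pos m) n"
    using T by (auto simp: triples_def reflect_def intro: coprime_pos_complement[OF assms])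
next
  fix T assume T: "T \<in> triples (coprime_pos m) n"
  then show "reflect n (reflect n T) = T"
    by (auto simp: triples_def reflect_def)
  show "reflect n T \<in> triples (coprime_pos m \<inter> {..<n}) (2 * n)"
    by (rule reflect_triples[OF assms T])
qed

lemma not_dvd_coprime_pos:
  assumes "prime p" "p dvd m" "x \<in> coprime_pos m"
  shows "\<not> p dvd x"
  using assms by (auto simp: coprime_pos_def dest: coprime_common_divisor not_prime_unit)

lemma recip3_factor: "recip3 (x, y, z) = 1 / of_nat x * (1 / of_nat y) * (1 / of_nat z)"
  by (simp add: recip3_def)

lemma p_integral_recip3:
  assumes "prime p" "\<not> p dvd x" "\<not> p dvd y" "\<not> p dvd z"
  shows "p_integral p (recip3 (x, y, z))"
  unfolding recip3_factor using assms by (intro p_integral_mult p_integral_inverse)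

lemma pcong_mult3:
  assumes "prime p" "pcong p a u u'" "pcong p a v v'" "pcong p a w w'"
    "p_integral p u'" "p_integral p v'" "p_integral p w'"
  shows "pcong p a (u * v * w) (u' * v' * w')"
  using assms by (metis pcong_mult p_integral_mult p_integral_pcong)

lemma recip_translate:
  assumes "prime p" "p ^ a dvd n" "p dvd n" "\<not> p dvd x"
  shows "pcong p a (1 / of_nat (x + n * b)) (1 / of_nat x)"
proof (rule pcong_inverse[OF assms(1)])
  have "[x + n * b = x + 0] (mod p ^ a)"
    using assms(2) by (intro cong_add) (auto simp: cong_0_iff)
  then show "pcong p a (of_nat (x + n * b)) (of_nat x)"
    by (intro pcong_of_nat assms) simp
  show "\<not> p dvd x + n * b"
    using assms by (metis dvd_add_left_iff dvd_mult2)
qed (use assms in auto)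

text \<open>The two sides differ by \<open>n / (x (n - x))\<close>, whose denominator is prime to
  \<open>p\<close>.\<close>

lemma recip_complement:
  assumes "prime p" "p ^ a dvd n" "p dvd n" "\<not> p dvd x" "x < n"
  shows "pcong p a (1 / of_nat (n - x)) (- (1 / of_nat x))"
proof -
  have nd: "\<not> p dvd n - x"
    using assms by (metis dvd_diffD1 less_imp_le)
  have "pcong p a (1 / of_nat (n - x) * (1 / of_nat x) * of_nat n)
      (1 / of_nat (n - x) * (1 / of_nat x) * 0)"
    using assms nd by (intro pcong_scale p_integral_mult p_integral_inverse pcong_of_nat_zero)
  moreover have "1 / of_nat (n - x) * (1 / of_nat x) * of_nat n
      = 1 / of_nat (n - x) - (- (1 / of_nat x :: rat))"
  proof -
    have "x > 0"
      using assms(4) by (metis dvd_0_right gr0I)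
    then show ?thesis
      using assms(5) by (simp add: of_nat_diff field_simps)
  qed
  ultimately show ?thesis
    by (simp add: pcong_zero_iff[of p a "1 / of_nat (n - x)"])
qed

lemma recip3_translate:
  assumes "prime p" "p ^ a dvd n" "p dvd m" "m dvd n" "T \<in> triples (coprime_pos m) N"
  shows "pcong p a (recip3 (translate n T A)) (recip3 T)"
proof -
  obtain x y z b c d where [simp]: "T = (x, y, z)" "A = (b, c, d)"
    by (cases T, cases A)
  have "\<not> p dvd x" "\<not> p dvd y" "\<not> p dvd z"
    using assms not_dvd_coprime_pos by (auto simp: triples_def)
  moreover have "p dvd n"
    using assms by (meson dvd_trans)
  ultimately show ?thesis
    using assms(1,2)
    by (simp only: \<open>T = _\<close> \<open>A = _\<close> translate_def recip3_factor prod.case)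
      (intro pcong_mult3 recip_translate p_integral_inverse)
qed

lemma recip3_reflect:
  assumes "prime p" "p ^ a dvd n" "p dvd m" "m dvd n" "T \<in> triples (coprime_pos m) n"
  shows "pcong p a (recip3 (reflect n T)) (- recip3 T)"
proof -
  obtain x y z where [simp]: "T = (x, y, z)"
    by (cases T)
  have "\<not> p dvd x" "\<not> p dvd y" "\<not> p dvd z" "x < n" "y < n" "z < n"
    using assms not_dvd_coprime_pos by (auto simp: triples_def coprime_pos_def)
  moreover have "p dvd n"
    using assms by (meson dvd_trans)
  moreover have "- recip3 T = (- (1 / of_nat x)) * (- (1 / of_nat y)) * (- (1 / of_nat z))"
    by (simp add: recip3_factor)
  ultimately show ?thesis
    using assms(1,2)
    by (simp only: \<open>T = _\<close> reflect_def recip3_factor prod.case)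
      (intro pcong_mult3 recip_complement p_integral_inverse p_integral_minus)
qed

text \<open>
  Negating residues modulo \<open>n\<close> turns residue triples of sum \<open>2 n\<close> into residue triples of
  sum \<open>n\<close> and, modulo \<open>p ^ a\<close>, changes the sign of the summand: hence the difference on the
  right-hand side.
\<close>

lemma weighted_triples_multiple:
  fixes w :: "nat \<times> nat \<times> nat \<Rightarrow> rat"
  assumes p: "prime p" "p ^ a dvd n" "p dvd m" "m dvd n" and "n > 0" and w: "\<And>T. p_integral p (w T)"
  shows "pcong p a (\<Sum>T\<in>triples (coprime_pos m) (t * n). w T * recip3 T)
    (\<Sum>T\<in>triples (coprime_pos m) n.
       ((\<Sum>A\<in>{(a, b, c). a + b + c + 1 = t}. w (translate n T A))
         - (\<Sum>A\<in>{(a, b, c). a + b + c + 2 = t}. w (translate n (reflect n T) A))) * recip3 T)"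
proof -
  have "m \<noteq> 0"
    using p(4) \<open>n > 0\<close> by auto
  then have m: "1 < m"
    using p(1,3) by (metis dvd_1_iff_1 less_one linorder_neqE_nat not_prime_1 One_nat_def)
  define L where "L s = {(a, b, c). a + b + c + s = t}" for s
  have block: "pcong p a
      (\<Sum>A\<in>B. w (translate n T A) * recip3 (translate n T A))
          ((\<Sum>A\<in>B. w (translate n T A)) * recip3 T)"
    if "T \<in> triples (coprime_pos m) N" for T N B
    unfolding sum_distrib_right
    using that p by (intro pcong_sum pcong_scale w recip3_translate)
  have "(\<Sum>T\<in>triples (coprime_pos m) (t * n). w T * recip3 T) =
      (\<Sum>T\<in>triples (coprime_pos m) n. \<Sum>A\<in>L 1. w (translate n T A) * recip3 (translate n T A))
      + (\<Sum>T\<in>triples (coprime_pos m) n.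
           \<Sum>A\<in>L 2. w (translate n (reflect n T) A) * recip3 (translate n (reflect n T) A))"
    unfolding L_def
    by (subst sum_triples_blocks[OF \<open>n > 0\<close> p(4) m])
      (simp add: triples_less sum_triples_reflect[OF p(4)])
  also have "pcong p a \<dots>
      ((\<Sum>T\<in>triples (coprime_pos m) n. (\<Sum>A\<in>L 1. w (translate n T A)) * recip3 T)
       + (\<Sum>T\<in>triples (coprime_pos m) n. (\<Sum>A\<in>L 2. w (translate n (reflect n T) A)) * (- recip3 T)))"
  proof (intro pcong_add[OF p(1)] pcong_sum[OF p(1)])
    fix T assume T: "T \<in> triples (coprime_pos m) n"
    then show "pcong p a (\<Sum>A\<in>L 1. w (translate n T A) * recip3 (translate n T A))
        ((\<Sum>A\<in>L 1. w (translate n T A)) * recip3 T)"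
      by (rule block)
    have "reflect n T \<in> triples (coprime_pos m) (2 * n)"
      using reflect_triples[OF p(4) T] by (auto simp: triples_def)
    note block[OF this, of "L 2"]
    also have "pcong p a ((\<Sum>A\<in>L 2. w (translate n (reflect n T) A)) * recip3 (reflect n T))
        ((\<Sum>A\<in>L 2. w (translate n (reflect n T) A)) * (- recip3 T))"
      using p T w by (intro pcong_scale p_integral_sum recip3_reflect)
    finally show "pcong p a
        (\<Sum>A\<in>L 2. w (translate n (reflect n T) A) * recip3 (translate n (reflect n T) A))
        ((\<Sum>A\<in>L 2. w (translate n (reflect n T) A)) * (- recip3 T))"
      using p(1) by simp
  qed
  finally show ?thesis
    by (simp add: L_def left_diff_distrib sum_subtractf sum_negf)
qed

section \<open>Counting the block triples, and the factor \<open>t\<close> for constant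
  weight\<close>

lemma card_triples_total: "2 * card {(a, b, c). a + b + c = (s::nat)} = (s + 1) * (s + 2)"
proof -
  have "{(a, b, c). a + b + c = s} = (SIGMA a:{..s}. (\<lambda>b. (b, s - a - b)) ` {..s - a})"
    by auto
  then have "card {(a, b, c). a + b + c = s} = (\<Sum>a\<le>s. card ((\<lambda>b. (b, s - a - b)) ` {..s - a}))"
    by simp
  also have "\<dots> = (\<Sum>a\<le>s. s - a + 1)"
    by (intro sum.cong) (auto simp: card_image inj_on_def)
  also have "\<dots> = (\<Sum>a\<le>s. a + 1)"
    by (rule sum.reindex_bij_witness[where i = "\<lambda>a. s - a" and j = "\<lambda>a. s - a"]) auto
  also have "2 * \<dots> = (s + 1) * (s + 2)"
    by (induction s) auto
  finally show ?thesis .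
qed

lemma card_triples_total_1: "2 * card {(a, b, c). a + b + c + 1 = (t::nat)} = t * (t + 1)"
proof (cases t)
  case (Suc s)
  then have "{(a, b, c). a + b + c + 1 = t} = {(a, b, c). a + b + c = s}"
    by auto
  then show ?thesis
    using Suc card_triples_total[of s] by simp
qed (simp add: case_prod_unfold)

lemma card_triples_total_2: "2 * card {(a, b, c). a + b + c + 2 = (t::nat)} = t * (t - 1)"
proof (cases "t < 2")
  case True
  then have "{(a, b, c). a + b + c + 2 = t} = {}" "t * (t - 1) = 0"
    by auto
  then show ?thesis
    by (metis card.empty mult_0_right)
next
  case False
  then obtain s where s: "t = s + 2"
    by (metis add.commute le_Suc_ex not_less)
  then have "{(a, b, c). a + b + c + 2 = t} = {(a, b, c). a + b + c = s}"
    by auto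
  then show ?thesis
    using s card_triples_total[of s] by simp
qed

text \<open>The counts are the binomial coefficients \<open>t + 1\<close> over \<open>2\<close> and
  \<open>t\<close> over \<open>2\<close>, and Pascal's rule gives their difference.\<close>

lemma card_triples_total_diff:
  "of_nat (card {(a, b, c). a + b + c + 1 = (t::nat)})
      - of_nat (card {(a, b, c). a + b + c + 2 = t}) = (of_nat t :: rat)"
proof -
  define A B where "A = card {(a, b, c). a + b + c + 1 = t}"
      and "B = card {(a, b, c). a + b + c + 2 = t}"
  have "2 * A = t * (t + 1)" "2 * B = t * (t - 1)"
    unfolding A_def B_def by (rule card_triples_total_1 card_triples_total_2)+
  then have "2 * A = 2 * (B + t)"
    by (cases t) auto
  then have "A = B + t"
    by simp
  then show ?thesis
    unfolding A_def[symmetric] B_def[symmetric] by simp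
qed

text \<open>For weight one the inner sums of \<open>weighted_triples_multiple\<close> are the two
  block counts, and only their difference \<open>t\<close> matters.\<close>

lemma sum_recip3_multiple:
  assumes "prime p" "p ^ a dvd n" "p dvd m" "m dvd n" "n > 0"
  shows "pcong p a (sum recip3 (triples (coprime_pos m) (t * n)))
    (of_nat t * sum recip3 (triples (coprime_pos m) n))"
proof -
  have "pcong p a (\<Sum>T\<in>triples (coprime_pos m) (t * n). 1 * recip3 T)
    (\<Sum>T\<in>triples (coprime_pos m) n. ((\<Sum>A\<in>{(a, b, c). a + b + c + 1 = t}. 1)
         - (\<Sum>A\<in>{(a, b, c). a + b + c + 2 = t}. 1)) * recip3 T)"
    using assms(1) by (intro weighted_triples_multiple assms) simp
  then show ?thesis
    by (simp only: sum_constant card_triples_total_diff mult_1 mult_1_right sum_distrib_left)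
qed

lemma odd_prime_not_dvd_2: "prime p \<Longrightarrow> odd p \<Longrightarrow> \<not> p dvd (2::nat)"
  by (metis dvd_refl primes_dvd_imp_eq two_is_prime_nat)

lemma sum_of_bool_mult:
  fixes f :: "'a \<Rightarrow> rat"
  assumes "finite A"
  shows "(\<Sum>x\<in>A. of_bool (P x) * f x) = sum f {x \<in> A. P x}"
  unfolding sum.inter_filter[OF assms] by (rule sum.cong) auto

text \<open>
  Compute the sum over the all-even triples of total \<open>2 n\<close> in two ways: halving gives \<open>Z / 8\<close>,
  and reduction modulo the odd number \<open>n\<close>, which flips the parity of every translated entry,
  gives \<open>Z - 2 A\<close>, where \<open>A\<close> is the all-odd sum of total \<open>n\<close>.
\<close>

lemma sum_recip3_all_odd:
  assumes p: "prime p" "p ^ a dvd n" "p dvd m" "m dvd n" and "odd p" "odd n"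
  shows "pcong p a (\<Sum>(i, j, k)\<in>{(i, j, k). i \<in> coprime_pos m \<and> j \<in> coprime_pos m \<and> k \<in> coprime_pos m
            \<and> odd i \<and> odd j \<and> odd k \<and> i + j + k = n}. 1 / (of_nat i * of_nat j * of_nat k))
    (7 / 16 * sum recip3 (triples (coprime_pos m) n))"
    (is "pcong p a ?A (7 / 16 * ?Z)")
proof -
  define all_odd where "all_odd = (\<lambda>(i::nat, j::nat, k::nat). odd i \<and> odd j \<and> odd k)"
  define all_even where "all_even = (\<lambda>(i::nat, j::nat, k::nat). even i \<and> even j \<and> even k)"
  have n: "n > 0"
    using \<open>odd n\<close> by (simp add: odd_pos)
  have "odd m"
    using p(4) \<open>odd n\<close> by (metis dvd_trans)
  then have cop2: "coprime 2 m"
    by simp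
  have A: "?A = (\<Sum>T\<in>triples (coprime_pos m) n. of_bool (all_odd T) * recip3 T)"
  proof -
    have "?A = sum recip3 {T \<in> triples (coprime_pos m) n. all_odd T}"
      unfolding recip3_def by (rule sum.cong) (auto simp: triples_def all_odd_def)
    then show ?thesis
      by (simp only: sum_of_bool_mult[OF finite_triples])
  qed
  have "(\<Sum>T\<in>triples (coprime_pos m) (2 * n). of_bool (all_even T) * recip3 T) =
      sum recip3 {T \<in> triples (coprime_pos m) (2 * n). all_even T}"
    by (rule sum_of_bool_mult[OF finite_triples])
  also have "\<dots> = (\<Sum>T\<in>triples (coprime_pos m) n. 1 / 8 * recip3 T)"
    by (rule sum.reindex_bij_witness[where i = "\<lambda>(i, j, k). (2 * i, 2 * j, 2 * k)"
          and j = "\<lambda>(i, j, k). (i div 2, j div 2, k div 2)"])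
      (use cop2 in \<open>auto simp: triples_def all_even_def coprime_pos_def recip3_def elim!: evenE\<close>)
  finally have even: "(\<Sum>T\<in>triples (coprime_pos m) (2 * n). of_bool (all_even T) * recip3 T)
      = 1 / 8 * ?Z"
    by (simp add: sum_distrib_left)
  have L1: "{(a, b, c). a + b + c + 1 = (2::nat)} = {(1, 0, 0), (0, 1, 0), (0, 0, 1)}"
    by auto
  have L2: "{(a, b, c). a + b + c + 2 = (2::nat)} = {(0, 0, 0)}"
    by auto
  have "pcong p a (\<Sum>T\<in>triples (coprime_pos m) (2 * n). of_bool (all_even T) * recip3 T)
     (\<Sum>T\<in>triples (coprime_pos m) n.
       ((\<Sum>A\<in>{(a, b, c). a + b + c + 1 = 2}. of_bool (all_even (translate n T A)))
         - (\<Sum>A\<in>{(a, b, c). a + b + c + 2 = 2}. of_bool (all_even (translate n (reflect n T) A))))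
             * recip3 T)"
    by (rule weighted_triples_multiple[OF p n]) (use p in auto)
  also have "\<dots> = (\<Sum>T\<in>triples (coprime_pos m) n. recip3 T - 2 * (of_bool (all_odd T) * recip3 T))"
  proof (rule sum.cong[OF refl])
    fix T assume "T \<in> triples (coprime_pos m) n"
    then obtain x y z where T: "T = (x, y, z)" "x + y + z = n"
      by (auto simp: triples_def)
    \<comment> \<open>An odd total leaves one or three odd entries. With three, no single
      translation makes all entries even but the reflection does, so the coefficient is
      \<open>0 - 1\<close>. With one, exactly one translation does and the reflection does not, so
      it is \<open>1 - 0\<close>.\<close>
    then have "odd x \<and> odd y \<and> odd z \<or> odd x \<and> even y \<and> even z
        \<or> even x \<and> odd y \<and> even z \<or> even x \<and> even y \<and> odd z"
      using \<open>odd n\<close> by auto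
    then show "((\<Sum>A\<in>{(a, b, c). a + b + c + 1 = 2}. of_bool (all_even (translate n T A)))
         - (\<Sum>A\<in>{(a, b, c). a + b + c + 2 = 2}. of_bool (all_even (translate n (reflect n T) A))))
             * recip3 T
        = recip3 T - 2 * (of_bool (all_odd T) * recip3 T)"
      unfolding L1 L2 T(1) using \<open>odd n\<close> T(2)
      by (elim disjE) (auto simp: all_even_def all_odd_def translate_def reflect_def)
  qed
  also have "\<dots> = ?Z - 2 * ?A"
    unfolding A by (simp only: sum_subtractf sum_distrib_left)
  finally have "pcong p a (1 / 8 * ?Z) (?Z - 2 * ?A)"
    by (simp add: even)
  moreover have "p_integral p (1 / 2)"
    using p_integral_inverse[of p 2] odd_prime_not_dvd_2[OF p(1) \<open>odd p\<close>] by simp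
  \<comment> \<open>Dividing by \<open>2\<close>, which \<open>p\<close> does not divide, leaves
    \<open>?A \<equiv> ?Z / 2 - ?Z / 16\<close>: the origin of \<open>7 / 16\<close>.\<close>
  ultimately have "pcong p a (1 / 2 * (1 / 8 * ?Z)) (1 / 2 * (?Z - 2 * ?A))"
    using p(1) by (intro pcong_scale)
  then show ?thesis
    unfolding pcong_zero_iff[of p a "_ * _"] pcong_zero_iff[of p a ?A]
    using pcong_minus by (simp add: algebra_simps)
qed

section \<open>From total \<open>n\<close> to total \<open>p n\<close>, with one more power of
  \<open>p\<close>\<close>

lemma pcong_fermat:
  assumes "prime p" "\<not> p dvd x"
  shows "pcong p 1 (of_nat x ^ (p - 1)) 1"
proof -
  have "[x ^ (p - 1) = 1] (mod p ^ 1)"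
    using fermat_theorem[OF assms] by simp
  from pcong_of_nat[OF assms(1) this] show ?thesis
    by simp
qed

lemma pcong_recip_fermat:
  assumes "prime p" "\<not> p dvd x"
  shows "pcong p 1 (1 / of_nat x) (of_nat x ^ (p - 2))"
proof -
  have "x > 0"
    using assms(2) by (metis dvd_0_right gr0I)
  moreover have "p - 1 = Suc (p - 2)"
    using prime_ge_2_nat[OF assms(1)] by linarith
  moreover have "pcong p 1 (1 / of_nat x * of_nat x ^ (p - 1)) (1 / of_nat x * 1)"
    by (intro pcong_scale p_integral_inverse pcong_fermat assms)
  ultimately have "pcong p 1 (of_nat x ^ (p - 2)) (1 / of_nat x)"
    by (simp del: One_nat_def)
  then show ?thesis
    by (rule pcong_sym)
qed

text \<open>The exact error is \<open>b ^ 2 n ^ 2 / (x ^ 2 (x + n b))\<close>, and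
  \<open>n ^ 2\<close> is divisible by \<open>p ^ (2 a)\<close>, where
  \<open>2 a \<ge> a + 1\<close>.\<close>

lemma recip_translate_first_order:
  assumes "prime p" "p ^ a dvd n" "a \<ge> 1" "\<not> p dvd x"
  shows "pcong p (a + 1) (1 / of_nat (x + n * b))
      (1 / of_nat x * (1 - of_nat n * (of_nat b / of_nat x)))"
proof -
  have "p dvd n"
    using assms(2,3) by (meson dvd_power dvd_trans zero_less_one order_less_le_trans)
  then have nd: "\<not> p dvd x + n * b"
    using assms(4) by (metis dvd_add_left_iff dvd_mult2)
  have "pcong p (a + a) (of_nat n * of_nat n) 0"
    by (intro pcong_mult_zero pcong_of_nat_zero assms)
  then have "pcong p (a + 1) (of_nat n * of_nat n) 0"
    using assms by (elim pcong_weaken[rotated]) auto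
  then have "pcong p (a + 1) (of_nat b * of_nat b * (1 / of_nat x) * (1 / of_nat x) *
      (1 / of_nat (x + n * b)) * (of_nat n * of_nat n))
     (of_nat b * of_nat b * (1 / of_nat x) * (1 / of_nat x) * (1 / of_nat (x + n * b)) * 0)"
    using assms nd by (intro pcong_scale p_integral_mult p_integral_inverse p_integral_of_nat)
  moreover have "of_nat b * of_nat b * (1 / of_nat x) * (1 / of_nat x) * (1 / of_nat (x + n * b)) *
      (of_nat n * of_nat n)
      = 1 / of_nat (x + n * b) - (1 / of_nat x * (1 - of_nat n * (of_nat b / of_nat x :: rat)))"
  proof -
    have "of_nat x \<noteq> (0::rat)" "of_nat (x + n * b) \<noteq> (0::rat)"
      using assms(4) nd by (metis dvd_0_right of_nat_eq_0_iff)+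
    then show ?thesis
      by (simp add: divide_simps) (simp add: algebra_simps)
  qed
  ultimately show ?thesis
    by (subst pcong_zero_iff) (simp only: mult_zero_right)
qed

lemma recip3_translate_first_order:
  assumes "prime p" "p ^ a dvd n" "a \<ge> 1" "\<not> p dvd x" "\<not> p dvd y" "\<not> p dvd z"
  shows "pcong p (a + 1) (recip3 (translate n (x, y, z) (b, c, d)))
    (recip3 (x, y, z) * (1 - of_nat n *
        (of_nat b / of_nat x + of_nat c / of_nat y + of_nat d / of_nat z)))"
proof -
  define u v w :: rat
    where "u = of_nat b / of_nat x" and "v = of_nat c / of_nat y" and "w = of_nat d / of_nat z"
  have int: "p_integral p u" "p_integral p v" "p_integral p w"
    unfolding u_def v_def w_def using assms by (auto intro!: p_integral_divide)
  have "pcong p (a + 1) (recip3 (translate n (x, y, z) (b, c, d)))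
     ((1 / of_nat x * (1 - of_nat n * u)) * (1 / of_nat y * (1 - of_nat n * v)) *
         (1 / of_nat z * (1 - of_nat n * w)))"
    unfolding translate_def prod.case recip3_factor u_def v_def w_def
    by (intro pcong_mult3 recip_translate_first_order assms p_integral_mult p_integral_diff
        p_integral_inverse p_integral_1 p_integral_of_nat p_integral_divide)
  also have "pcong p (a + 1) \<dots> (recip3 (x, y, z) * (1 - of_nat n * (u + v + w)))"
  proof -
    have "pcong p (a + a) (of_nat n * of_nat n) 0"
      by (intro pcong_mult_zero pcong_of_nat_zero assms)
    then have "pcong p (a + 1) (of_nat n * of_nat n) 0"
      using assms by (elim pcong_weaken[rotated]) auto
    then have "pcong p (a + 1)
       (recip3 (x, y, z) * (u * v + u * w + v * w - of_nat n * u * v * w) * (of_nat n * of_nat n))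
       (recip3 (x, y, z) * (u * v + u * w + v * w - of_nat n * u * v * w) * 0)"
      using assms int
      by (intro pcong_scale p_integral_mult p_integral_diff p_integral_add p_integral_recip3
          p_integral_of_nat)
    moreover have "(i * (1 - c * u)) * (j * (1 - c * v)) * (k * (1 - c * w))
        - i * j * k * (1 - c * (u + v + w))
        = i * j * k * (u * v + u * w + v * w - c * u * v * w) * (c * c)" for i j k c :: rat
      by (simp add: algebra_simps)
    ultimately show ?thesis
      by (subst pcong_zero_iff) (simp only: recip3_factor mult_zero_right)
  qed
  finally show ?thesis
    using assms(1) by (simp add: u_def v_def w_def)
qed


lemma sum_swap12:
  "(\<Sum>(b, c, d)\<in>{(b, c, d). b + c + d + s = (t::nat)}. of_nat c)
      = (\<Sum>(b, c, d)\<in>{(b, c, d). b + c + d + s = t}. of_nat b :: rat)"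
  by (rule sum.reindex_bij_witness[where i = "\<lambda>(b, c, d). (c, b, d)"
      and j = "\<lambda>(b, c, d). (c, b, d)"]) auto

lemma sum_swap13:
  "(\<Sum>(b, c, d)\<in>{(b, c, d). b + c + d + s = (t::nat)}. of_nat d)
      = (\<Sum>(b, c, d)\<in>{(b, c, d). b + c + d + s = t}. of_nat b :: rat)"
  by (rule sum.reindex_bij_witness[where i = "\<lambda>(b, c, d). (d, c, b)"
      and j = "\<lambda>(b, c, d). (d, c, b)"]) auto

text \<open>By symmetry the three coordinates have equal sums, and in every triple they add up to
  \<open>t - s\<close>.\<close>

lemma sum_total_first:
  assumes "s \<le> t"
  shows "3 * (\<Sum>(b, c, d)\<in>{(b, c, d). b + c + d + s = t}. of_nat b :: rat)
    = of_nat (t - s) * of_nat (card {(b, c, d). b + c + d + s = t})"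
proof -
  let ?L = "{(b, c, d). b + c + d + s = t}"
  have "3 * (\<Sum>(b, c, d)\<in>?L. of_nat b :: rat) =
     (\<Sum>(b, c, d)\<in>?L. of_nat b) + (\<Sum>(b, c, d)\<in>?L. of_nat c) + (\<Sum>(b, c, d)\<in>?L. of_nat d)"
    unfolding sum_swap12 sum_swap13 by simp
  also have "\<dots> = (\<Sum>T\<in>?L. of_nat (t - s))"
    unfolding sum.distrib[symmetric] by (rule sum.cong) auto
  finally show ?thesis
    by simp
qed

text \<open>All three coordinates of the block index have the same sum \<open>K\<close>, so the
  first-order terms collect to \<open>n * K * R\<close> times \<open>recip3 (x, y, z)\<close>, with
  \<open>R\<close> the sum of the reciprocals. As \<open>n\<close> already contributes
  \<open>p ^ a\<close>, a single further factor \<open>p\<close> in \<open>K * R\<close>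
  suffices.\<close>

lemma sum_translates:
  assumes p: "prime p" "odd p" "p ^ a dvd n" "a \<ge> 1" "p dvd n"
    and nd: "\<not> p dvd x" "\<not> p dvd y" "\<not> p dvd z" and "p dvd x + y + z" and s: "s = 1 \<or> s = 2"
  shows "pcong p (a + 1) (\<Sum>A\<in>{(b, c, d). b + c + d + s = p}. recip3 (translate n (x, y, z) A))
    (of_nat (card {(b, c, d). b + c + d + s = p}) * recip3 (x, y, z))"
proof -
  let ?L = "{(b, c, d). b + c + d + s = p}"
  define K :: rat where "K = (\<Sum>(b, c, d)\<in>?L. of_nat b)"
  define R :: rat where "R = 1 / of_nat x + 1 / of_nat y + 1 / of_nat z"
  have intK: "p_integral p K" and intR: "p_integral p R"
    unfolding K_def R_def using p nd
        by (auto intro!: p_integral_sum p_integral_add p_integral_inverse)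
  have "p > 2"
    using p(1,2) prime_gt_1_nat[of p] by (cases "p = 2") auto
  have "p dvd 2 * card ?L"
    using s card_triples_total_1[of p] card_triples_total_2[of p] by auto
  then have card: "p dvd card ?L"
    using p odd_prime_not_dvd_2 by (meson prime_dvd_mult_iff)
  \<comment> \<open>For \<open>p > 3\<close> already \<open>K\<close> vanishes modulo \<open>p\<close>; for \<open>p = 3\<close> we have \<open>1 / x \<equiv> x\<close>, so \<open>R\<close> does.\<close>
  have KR: "pcong p 1 (K * R) 0"
  proof (cases "p = 3")
    case True
    have "pcong p 1 R (of_nat x ^ (p - 2) + of_nat y ^ (p - 2) + of_nat z ^ (p - 2))"
      unfolding R_def using p nd by (intro pcong_add pcong_recip_fermat)
    also have "\<dots> = of_nat (x + y + z)"
      using True by simp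
    also have "pcong p 1 (of_nat (x + y + z)) 0"
      using p \<open>p dvd x + y + z\<close> by (intro pcong_of_nat_zero) auto
    finally have "pcong p 1 R 0"
      using p by simp
    from pcong_scale[OF p(1) intK this] show ?thesis
      by simp
  next
    case False
    have "\<not> p dvd 3"
      using False \<open>p > 2\<close> by (auto dest: dvd_imp_le)
    have "pcong p 1 (of_nat (card ?L)) 0"
      using p card by (intro pcong_of_nat_zero) auto
    then have "pcong p 1 (of_nat (p - s) * (1 / of_nat 3) * of_nat (card ?L))
        (of_nat (p - s) * (1 / of_nat 3) * 0)"
      using p \<open>\<not> p dvd 3\<close> by (intro pcong_scale p_integral_mult p_integral_inverse
          p_integral_of_nat)
    moreover have "of_nat (p - s) * (1 / of_nat 3) * of_nat (card ?L) = K"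
      using sum_total_first[of s p] s \<open>p > 2\<close> by (auto simp: K_def)
    ultimately have "pcong p 1 K 0"
      by simp
    from pcong_scale[OF p(1) intR this] show ?thesis
      by (simp add: mult.commute)
  qed
  have "pcong p (a + 1) (\<Sum>A\<in>?L. recip3 (translate n (x, y, z) A))
     (\<Sum>(b, c, d)\<in>?L. recip3 (x, y, z) *
         (1 - of_nat n * (of_nat b / of_nat x + of_nat c / of_nat y + of_nat d / of_nat z)))"
    using p nd recip3_translate_first_order by (intro pcong_sum) auto
  also have "\<dots> = of_nat (card ?L) * recip3 (x, y, z) - recip3 (x, y, z) * (of_nat n * (K * R))"
  proof -
    have "(\<Sum>(b, c, d)\<in>?L. recip3 (x, y, z) *
        (1 - of_nat n * (of_nat b / of_nat x + of_nat c / of_nat y + of_nat d / of_nat z)))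
      = (\<Sum>(b, c, d)\<in>?L. recip3 (x, y, z)) - recip3 (x, y, z) * (of_nat n *
          ((\<Sum>(b, c, d)\<in>?L. of_nat b) / of_nat x + (\<Sum>(b, c, d)\<in>?L. of_nat c) / of_nat y
            + (\<Sum>(b, c, d)\<in>?L. of_nat d) / of_nat z))"
      unfolding case_prod_unfold
      by (simp add: right_diff_distrib sum_subtractf sum_distrib_left sum_divide_distrib
          distrib_left sum.distrib)
    then show ?thesis
      unfolding sum_swap12 sum_swap13 K_def R_def by (simp add: case_prod_unfold distrib_left)
  qed
  also have "pcong p (a + 1) \<dots> (of_nat (card ?L) * recip3 (x, y, z) - recip3 (x, y, z) * 0)"
    using p nd KR by (intro pcong_diff pcong_scale pcong_mult_zero pcong_refl p_integral_recip3
        pcong_of_nat_zero)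
  finally show ?thesis
    using p(1) by simp
qed

text \<open>Translations cost nothing modulo \<open>p ^ (a + 1)\<close> once they are summed over a
  block. Reflection changes the sign only modulo \<open>p ^ a\<close>, but it occurs with the
  coefficient \<open>p (p - 1) / 2\<close>, which supplies the missing factor
  \<open>p\<close>.\<close>

lemma sum_recip3_prime_multiple:
  assumes p: "prime p" "odd p" "p ^ a dvd n" "a \<ge> 1" "p dvd m" "m dvd n" "n > 0"
  shows "pcong p (a + 1) (sum recip3 (triples (coprime_pos m) (p * n)))
    (of_nat p * sum recip3 (triples (coprime_pos m) n))"
proof -
  have "m \<noteq> 0"
    using p(6,7) by auto
  then have m: "1 < m"
    using p(1,5) by (metis dvd_1_iff_1 less_one linorder_neqE_nat not_prime_1 One_nat_def)
  have pn: "p dvd n"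
    using p by (meson dvd_trans)
  define R where "R s = triples (coprime_pos m \<inter> {..<n}) (s * n)" for s
  define L where "L s = {(b, c, d). b + c + d + s = p}" for s
  have "sum recip3 (triples (coprime_pos m) (p * n)) =
     (\<Sum>s\<in>{1, 2}. \<Sum>T\<in>R s. \<Sum>A\<in>L s. recip3 (translate n T A))"
    unfolding R_def L_def by (rule sum_triples_blocks[OF p(7,6) m])
  also have "pcong p (a + 1) \<dots> (\<Sum>s\<in>{1, 2}. \<Sum>T\<in>R s. of_nat (card (L s)) * recip3 T)"
  proof (intro pcong_sum p)
    fix s T assume s: "s \<in> {1, 2::nat}" and T: "T \<in> R s"
    obtain x y z where xyz: "T = (x, y, z)"
      by (cases T)
    have "\<not> p dvd x" "\<not> p dvd y" "\<not> p dvd z"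
      using T not_dvd_coprime_pos[OF p(1,5)] by (auto simp: xyz R_def triples_def)
    moreover have "p dvd x + y + z"
      using T pn by (auto simp: xyz R_def triples_def)
    ultimately show "pcong p (a + 1) (\<Sum>A\<in>L s. recip3 (translate n T A))
        (of_nat (card (L s)) * recip3 T)"
      unfolding L_def xyz using s by (intro sum_translates p pn) auto
  qed
  also have "\<dots> = of_nat (card (L 1)) * sum recip3 (triples (coprime_pos m) n)
      + of_nat (card (L 2)) * (\<Sum>T\<in>triples (coprime_pos m) n. recip3 (reflect n T))"
    unfolding R_def
    by (simp add: triples_less sum_triples_reflect[OF p(6)] sum_distrib_left)
  also have "pcong p (a + 1) \<dots> (of_nat (card (L 1)) * sum recip3 (triples (coprime_pos m) n)
      + of_nat (card (L 2)) * (- sum recip3 (triples (coprime_pos m) n)))"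
  proof (intro pcong_add[OF p(1)] pcong_refl[OF p(1)])
    have "p dvd 2 * card (L 2)"
      using card_triples_total_2[of p] by (simp add: L_def)
    then have "p dvd card (L 2)"
      using p odd_prime_not_dvd_2 by (meson prime_dvd_mult_iff)
    then obtain c where c: "card (L 2) = p * c"
      by blast
    have "pcong p a (\<Sum>T\<in>triples (coprime_pos m) n. recip3 (reflect n T))
        (\<Sum>T\<in>triples (coprime_pos m) n. - recip3 T)"
      using p by (intro pcong_sum recip3_reflect)
    then have "pcong p (a + 1) (of_nat p ^ 1 * (\<Sum>T\<in>triples (coprime_pos m) n. recip3 (reflect n T)))
       (of_nat p ^ 1 * - sum recip3 (triples (coprime_pos m) n))"
      using p by (intro pcong_p_power) (auto simp: sum_negf)
    then have "pcong p (a + 1) (of_nat c *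
        (of_nat p ^ 1 * (\<Sum>T\<in>triples (coprime_pos m) n. recip3 (reflect n T))))
       (of_nat c * (of_nat p ^ 1 * - sum recip3 (triples (coprime_pos m) n)))"
      by (rule pcong_scale[OF p(1) p_integral_of_nat[OF p(1)]])
    then show "pcong p (a + 1) (of_nat (card (L 2)) *
        (\<Sum>T\<in>triples (coprime_pos m) n. recip3 (reflect n T)))
       (of_nat (card (L 2)) * - sum recip3 (triples (coprime_pos m) n))"
      by (simp add: c mult_ac)
  qed
  also have "\<dots> = of_nat p * sum recip3 (triples (coprime_pos m) n)"
    unfolding card_triples_total_diff[of p, symmetric] by (simp add: L_def left_diff_distrib)
  finally show ?thesis
    using p(1) by simp
qed

subsection \<open>Power sums and Bernoulli numbers\<close>

lemma bernoulli_sum: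
  "(\<Sum>i\<le>n. of_nat (Suc n choose i) * bernoulli i) = (if n = 0 then 1 else 0)"
  using bernoulli_recurrence[of n] by auto

text \<open>The right-hand side, times \<open>m + 1\<close>, is a polynomial \<open>P\<close> with
  \<open>P 0 = 0\<close>, so it is enough that \<open>P (r + 1) - P r = (m + 1) r ^ m\<close>.
  Expanding the powers of \<open>r + 1\<close> and collecting powers of \<open>r\<close>, the
  coefficient of \<open>r ^ s\<close> contains a Bernoulli recurrence sum, which vanishes except for
  \<open>s = m\<close>.\<close>

lemma faulhaber:
  "(\<Sum>j<r. of_nat j ^ m) =
    (\<Sum>i\<le>m. of_nat (Suc m choose i) * bernoulli i * of_nat r ^ (Suc m - i)) /
        (of_nat (Suc m) :: rat)"
proof -
  define P :: "nat \<Rightarrow> rat"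
    where "P r = (\<Sum>i\<le>m. of_nat (Suc m choose i) * bernoulli i * of_nat r ^ (Suc m - i))" for r
  have step: "P (Suc r) - P r = of_nat (Suc m) * of_nat r ^ m" for r
  proof -
    have binom: "of_nat (Suc r) ^ k - of_nat r ^ k
        = (\<Sum>s<k. of_nat (k choose s) * of_nat r ^ s :: rat)" for k
    proof -
      have "of_nat (Suc r) ^ k = (of_nat r + 1 :: rat) ^ k"
        by (simp add: add.commute)
      also have "\<dots> = (\<Sum>s\<le>k. of_nat (k choose s) * of_nat r ^ s)"
        by (simp add: binomial_ring)
      finally show ?thesis
        by (simp add: lessThan_Suc_atMost[symmetric])
    qed
    have "P (Suc r) - P r =
      (\<Sum>i\<le>m. of_nat (Suc m choose i) * bernoulli i *
          (of_nat (Suc r) ^ (Suc m - i) - of_nat r ^ (Suc m - i)))"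
      unfolding P_def by (simp only: right_diff_distrib sum_subtractf)
    also have "\<dots> = (\<Sum>i\<le>m. \<Sum>s<Suc m - i. of_nat (Suc m choose i) * bernoulli i *
        (of_nat (Suc m - i choose s) * of_nat r ^ s))"
      unfolding binom by (simp only: sum_distrib_left)
    also have "\<dots> = (\<Sum>s\<le>m. \<Sum>i\<le>m - s. of_nat (Suc m choose i) * bernoulli i *
        (of_nat (Suc m - i choose s) * of_nat r ^ s))"
      unfolding sum.Sigma[OF finite_atMost ballI[OF finite_lessThan]]
          sum.Sigma[OF finite_atMost ballI[OF finite_atMost]]
      by (rule sum.reindex_bij_witness[where i = "\<lambda>(s, i). (i, s)" and j = "\<lambda>(s, i). (i, s)"]) auto
    also have "\<dots> = (\<Sum>s\<le>m. of_nat r ^ s * of_nat (Suc m choose s) *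
        (\<Sum>i\<le>m - s. of_nat (Suc (m - s) choose i) * bernoulli i))"
    proof (rule sum.cong[OF refl])
      fix s assume "s \<in> {..m}"
      \<comment> \<open>Both products count pairs of disjoint subsets of sizes \<open>i\<close> and
        \<open>s\<close>, chosen in either order.\<close>
      have "(Suc m choose i) * (Suc m - i choose s) = (Suc m choose s) * (Suc (m - s) choose i)"
        if "i \<le> m - s" for i
      proof -
        have "(Suc m choose (s + i)) * ((s + i) choose s) = (Suc m choose s) * (Suc m - s choose i)"
          using that \<open>s \<in> {..m}\<close> choose_mult[of s "s + i" "Suc m"] by simp
        moreover have "(Suc m choose (s + i)) * ((s + i) choose i)
            = (Suc m choose i) * (Suc m - i choose s)"
          using that \<open>s \<in> {..m}\<close> choose_mult[of i "s + i" "Suc m"] by simp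
        moreover have "(s + i) choose s = (s + i) choose i"
          using binomial_symmetric[of s "s + i"] by simp
        ultimately show ?thesis
          using \<open>s \<in> {..m}\<close> by (simp add: Suc_diff_le)
      qed
      then have "of_nat (Suc m choose i) * of_nat (Suc m - i choose s)
          = (of_nat (Suc m choose s) * of_nat (Suc (m - s) choose i) :: rat)"
        if "i \<le> m - s" for i
        using that by (metis of_nat_mult)
      then show "(\<Sum>i\<le>m - s. of_nat (Suc m choose i) * bernoulli i *
          (of_nat (Suc m - i choose s) * of_nat r ^ s))
        = of_nat r ^ s * of_nat (Suc m choose s) *
            (\<Sum>i\<le>m - s. of_nat (Suc (m - s) choose i) * bernoulli i)"
        unfolding sum_distrib_left by (intro sum.cong refl)
            (simp add: ac_simps del: binomial_Suc_Suc)
    qed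
    also have "\<dots> = (\<Sum>s\<le>m. if s = m then of_nat r ^ m * of_nat (Suc m) else 0)"
      unfolding bernoulli_sum by (intro sum.cong) (auto simp del: of_nat_Suc binomial_Suc_Suc)
    finally show ?thesis
      by (simp add: mult.commute)
  qed
  have "of_nat (Suc m) * (\<Sum>j<r. of_nat j ^ m) = P r"
  proof (induction r)
    case 0
    show ?case
      by (auto simp: P_def Suc_diff_le simp del: binomial_Suc_Suc)
  next
    case (Suc r)
    then show ?case
      using step[of r] by (simp add: distrib_left del: of_nat_Suc)
  qed
  then show ?thesis
    unfolding P_def[symmetric] by (metis nonzero_mult_div_cancel_left of_nat_0_neq)
qed

text \<open>The recursion up to index \<open>n\<close> divides only by numbers at most
  \<open>n + 1\<close>, hence less than \<open>p\<close>.\<close>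

lemma p_integral_bernoulli: "prime p \<Longrightarrow> n + 2 \<le> p \<Longrightarrow> p_integral p (bernoulli n)"
proof (induction n rule: less_induct)
  case (less n)
  show ?case
  proof (cases n)
    case (Suc k)
    have "\<not> p dvd Suc (Suc k)"
      using less.prems Suc by (auto dest: dvd_imp_le)
    then show ?thesis
      using less Suc
      by (auto simp del: of_nat_Suc binomial_Suc_Suc intro!: p_integral_divide p_integral_minus
          p_integral_sum p_integral_mult)
  qed (use less in simp)
qed

text \<open>In Faulhaber's formula at \<open>r = p\<close> every term with \<open>i < k\<close>
  carries at least \<open>p ^ 2\<close>; the term \<open>i = k\<close> is
  \<open>p * bernoulli k\<close>.\<close>

lemma power_sum_mod_square:
  assumes "prime p" "k + 2 \<le> p"
  shows "pcong p 2 (\<Sum>j<p. of_nat j ^ k) (of_nat p * bernoulli k)"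
proof -
  have "\<not> p dvd Suc k"
    using assms by (auto dest: dvd_imp_le)
  then have inv: "p_integral p (1 / of_nat (Suc k))"
    by (rule p_integral_inverse)
  have p2: "pcong p 2 (of_nat p ^ (Suc k - i)) 0" if "i < k" for i
  proof -
    have "p ^ 2 dvd p ^ (Suc k - i)"
      using that by (intro le_imp_power_dvd) auto
    from pcong_of_nat_zero[OF assms(1) this] show ?thesis
      by simp
  qed
  have "pcong p 2 (\<Sum>i<k. of_nat (Suc k choose i) * bernoulli i * of_nat p ^ (Suc k - i))
     (\<Sum>i<k. of_nat (Suc k choose i) * bernoulli i * 0)"
    using assms
    by (intro pcong_sum pcong_scale p2 p_integral_mult p_integral_of_nat p_integral_bernoulli) auto
  then have "pcong p 2 (1 / of_nat (Suc k) *
      ((\<Sum>i<k. of_nat (Suc k choose i) * bernoulli i * of_nat p ^ (Suc k - i))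
       + of_nat (Suc k) * bernoulli k * of_nat p))
           (1 / of_nat (Suc k) * ((\<Sum>i<k. of_nat (Suc k choose i) * bernoulli i * 0)
       + of_nat (Suc k) * bernoulli k * of_nat p))"
    by (intro pcong_scale pcong_add pcong_refl assms inv)
  moreover have "(\<Sum>j<p. of_nat j ^ k)
      = 1 / of_nat (Suc k) * ((\<Sum>i<k. of_nat (Suc k choose i) * bernoulli i * of_nat p ^ (Suc k - i))
       + of_nat (Suc k) * bernoulli k * of_nat p)"
    unfolding faulhaber by (simp add: lessThan_Suc_atMost[symmetric] del: of_nat_Suc
        binomial_Suc_Suc)
  ultimately show ?thesis
    by (simp del: of_nat_Suc) (simp add: mult.commute)
qed

text \<open>The term \<open>j = 0\<close> contributes \<open>1 / 0 = 0\<close>.\<close>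

definition harmonic_below :: "nat \<Rightarrow> rat" where
  "harmonic_below r = (\<Sum>j<r. 1 / of_nat j)"

lemma power_sum_mod:
  assumes "prime p" "0 < k" "k + 2 \<le> p"
  shows "pcong p 1 (\<Sum>j\<in>{0<..<p}. of_nat j ^ k) 0"
proof -
  have "pcong p 1 (\<Sum>j<p. of_nat j ^ k) (of_nat p * bernoulli k)"
    using assms by (intro pcong_weaken[OF _ power_sum_mod_square]) auto
  also have "pcong p 1 (of_nat p * bernoulli k) 0"
    using assms p_integral_bernoulli[of p k] by (simp add: pcong_def)
  finally have "pcong p 1 (\<Sum>j<p. of_nat j ^ k) 0"
    using assms by simp
  moreover have "{..<p} = insert 0 {0<..<p}"
    using assms by auto
  ultimately show ?thesis
    using assms(2) by (simp add: power_0_left)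
qed

text \<open>Fermat replaces \<open>1 / j\<close> by \<open>j ^ (p - 2)\<close> and
  \<open>1 / r ^ 2\<close> by \<open>r ^ (p - 3)\<close>, and Faulhaber makes the inner sum a
  polynomial in \<open>r\<close>. The power sums over \<open>r\<close> then vanish modulo
  \<open>p\<close> except where the exponent is \<open>p - 1\<close>, that is for
  \<open>i = p - 3\<close>, which singles out one Bernoulli number.\<close>

lemma harmonic_double_sum:
  assumes "prime p" "odd p"
  shows "pcong p 1 (\<Sum>r\<in>{0<..<p}. 1 / of_nat r ^ 2 * harmonic_below r) (bernoulli (p - 3))"
proof -
  have "p > 2"
    using assms prime_gt_1_nat[of p] by (cases "p = 2") auto
  then have p3: "p \<ge> 3"
    by simp
  define c where "c i = of_nat (p - 1 choose i) * bernoulli i" for i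
  have intc: "p_integral p (c i)" if "i \<le> p - 2" for i
    unfolding c_def using that p3 assms
        by (intro p_integral_mult p_integral_of_nat p_integral_bernoulli) auto
  have nd: "\<not> p dvd r" if "r \<in> {0<..<p}" for r
    using that by (auto dest: dvd_imp_le)
  have nd1: "\<not> p dvd p - 1"
    using p3 by (auto dest: dvd_imp_le)
  have harm: "pcong p 1 (harmonic_below r)
      (1 / of_nat (p - 1) * (\<Sum>i\<le>p - 2. c i * of_nat r ^ (p - 1 - i)))"
    if "r \<in> {0<..<p}" for r
  proof -
    have "pcong p 1 (harmonic_below r) (\<Sum>j<r. of_nat j ^ (p - 2))"
      unfolding harmonic_below_def
    proof (intro pcong_sum assms)
      fix j assume "j \<in> {..<r}"
      \<comment> \<open>At \<open>j = 0\<close> both sides are \<open>0\<close>, since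
        \<open>p - 2 > 0\<close>.\<close>
      then show "pcong p 1 (1 / of_nat j) (of_nat j ^ (p - 2))"
        using pcong_recip_fermat[OF assms(1) nd[of j]] that p3 assms
        by (cases "j = 0") (auto simp: power_0_left)
    qed
    also have "\<dots> = 1 / of_nat (p - 1) * (\<Sum>i\<le>p - 2. c i * of_nat r ^ (p - 1 - i))"
    proof -
      have "Suc (p - 2) = p - 1"
        using p3 by simp
      then show ?thesis
        unfolding faulhaber c_def by simp
    qed
    finally show ?thesis .
  qed
  have sq: "pcong p 1 (1 / of_nat r ^ 2) (of_nat r ^ (p - 3))" if "r \<in> {0<..<p}" for r
  proof -
    have "pcong p 1 (1 / of_nat r * (1 / of_nat r)) (1 / of_nat r * of_nat r ^ (p - 2))"
      by (intro pcong_scale p_integral_inverse pcong_recip_fermat nd that assms)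
    moreover have "p - 2 = Suc (p - 3)"
      using p3 by simp
    ultimately show ?thesis
      using that by (simp add: power2_eq_square del: One_nat_def)
  qed
  have inner: "pcong p 1 (\<Sum>r\<in>{0<..<p}. of_nat r ^ (p - 3) * of_nat r ^ (p - 1 - i))
      (if i = p - 3 then of_nat (p - 1) else 0)"
    if i: "i \<le> p - 2" for i
  proof (cases "i = p - 2")
    case True
    then have "of_nat r ^ (p - 3) * of_nat r ^ (p - 1 - i) = (of_nat r ^ (p - 2) :: rat)" for r
      using p3 by (simp flip: power_add)
          (metis Suc_diff_Suc Suc_diff_le diff_Suc_Suc numeral_2_eq_2 numeral_3_eq_3 power_Suc2)
    then show ?thesis
      using power_sum_mod[OF assms(1), of "p - 2"] p3 True by simp
  next
    case False
    then have i3: "i \<le> p - 3"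
      using i by simp
    have "pcong p 1 (\<Sum>r\<in>{0<..<p}. of_nat r ^ (p - 3) * of_nat r ^ (p - 1 - i))
        (\<Sum>r\<in>{0<..<p}. of_nat r ^ (p - 3 - i))"
    proof (intro pcong_sum assms)
      fix r assume r: "r \<in> {0<..<p}"
      have "pcong p 1 (of_nat r ^ (p - 3 - i) * of_nat r ^ (p - 1)) (of_nat r ^ (p - 3 - i) * 1)"
        by (intro pcong_scale pcong_fermat p_integral_power p_integral_of_nat nd r assms)
      moreover have "p - 3 - i + (p - 1) = p - 3 + (p - 1 - i)"
        using i3 p3 by simp
      ultimately show "pcong p 1 (of_nat r ^ (p - 3) * of_nat r ^ (p - 1 - i))
          (of_nat r ^ (p - 3 - i))"
        by (simp flip: power_add)
    qed
    also have "pcong p 1 \<dots> (if i = p - 3 then of_nat (p - 1) else 0)"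
      using power_sum_mod[OF assms(1), of "p - 3 - i"] i3 assms by auto
    finally show ?thesis
      using assms by simp
  qed
  have "pcong p 1 (\<Sum>r\<in>{0<..<p}. 1 / of_nat r ^ 2 * harmonic_below r)
    (\<Sum>r\<in>{0<..<p}. of_nat r ^ (p - 3) *
        (1 / of_nat (p - 1) * (\<Sum>i\<le>p - 2. c i * of_nat r ^ (p - 1 - i))))"
  proof (intro pcong_sum assms)
    fix r assume r: "r \<in> {0<..<p}"
    have "p_integral p (of_nat r ^ (p - 3))"
      using assms by auto
    moreover have "p_integral p (1 / of_nat (p - 1) * (\<Sum>i\<le>p - 2. c i * of_nat r ^ (p - 1 - i)))"
      using assms intc nd1 by (intro p_integral_mult p_integral_inverse p_integral_sum
          p_integral_power p_integral_of_nat) auto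
    ultimately show "pcong p 1 (1 / of_nat r ^ 2 * harmonic_below r)
       (of_nat r ^ (p - 3) * (1 / of_nat (p - 1) * (\<Sum>i\<le>p - 2. c i * of_nat r ^ (p - 1 - i))))"
      using sq[OF r] harm[OF r] p_integral_pcong assms by (intro pcong_mult) blast+
  qed
  also have "\<dots> = 1 / of_nat (p - 1) *
      (\<Sum>i\<le>p - 2. c i * (\<Sum>r\<in>{0<..<p}. of_nat r ^ (p - 3) * of_nat r ^ (p - 1 - i)))"
    unfolding sum_distrib_left by (subst sum.swap) (simp add: ac_simps)
  also have "pcong p 1 \<dots> (1 / of_nat (p - 1) *
      (\<Sum>i\<le>p - 2. c i * (if i = p - 3 then of_nat (p - 1) else 0)))"
    using assms by (intro pcong_scale p_integral_inverse pcong_sum inner intc nd1) auto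
  also have "(\<Sum>i\<le>p - 2. c i * (if i = p - 3 then of_nat (p - 1) else 0))
      = c (p - 3) * of_nat (p - 1)"
    by (simp add: if_distrib cong: if_cong)
  also have "1 / of_nat (p - 1) * (c (p - 3) * of_nat (p - 1)) = c (p - 3)"
    using p3 by simp
  also have "pcong p 1 \<dots> (bernoulli (p - 3))"
  proof -
    \<comment> \<open>The remaining coefficient is
      \<open>(p - 1) (p - 2) / 2 = 1 + p (p - 3) / 2\<close>, hence \<open>1\<close> modulo
      \<open>p\<close>; the computation is carried out for its double.\<close>
    have "(p - 1 choose (p - 3)) = (p - 1 choose 2)"
      using p3 by (subst binomial_symmetric) auto
    also have "\<dots> = (p - 1) * (p - 2) div 2"
      using choose_two[of "p - 1"] by (simp add: numeral_2_eq_2)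
    also have "2 * \<dots> = (p - 1) * (p - 2)"
      using assms(2) by auto
    finally have "2 * (p - 1 choose (p - 3)) = p * (p - 3) + 2"
      using p3 by (auto simp: nat_le_iff_add algebra_simps)
    then have "p dvd 2 * ((p - 1 choose (p - 3)) - 1)"
      by (simp add: diff_mult_distrib2)
    then have "p dvd (p - 1 choose (p - 3)) - 1"
      using assms odd_prime_not_dvd_2 by (meson prime_dvd_mult_iff)
    moreover have "(p - 1 choose (p - 3)) \<ge> 1"
      using p3 by (simp add: Suc_le_eq)
    ultimately obtain c where "p - 1 choose (p - 3) = 1 + p * c"
      by (metis dvd_def le_add_diff_inverse)
    then have "[p - 1 choose (p - 3) = 1] (mod p ^ 1)"
      by (simp only: cong_def power_one_right mod_mult_self2)
    then have "pcong p 1 (bernoulli (p - 3) * of_nat (p - 1 choose (p - 3)))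
        (bernoulli (p - 3) * of_nat 1)"
      using assms p3 by (intro pcong_scale pcong_of_nat p_integral_bernoulli) auto
    then show ?thesis
      by (simp add: c_def mult.commute)
  qed
  finally show ?thesis
    using assms(1) by simp
qed

section \<open>Voronoi's congruence for the exponent \<open>p - 3\<close>\<close>

lemma power_add_first_order:
  fixes x y :: rat
  assumes "prime p" "p_integral p x" "pcong p 1 y 0"
  shows "pcong p 2 ((x + y) ^ k) (x ^ k + of_nat k * x ^ (k - 1) * y)"
proof (induction k)
  case (Suc k)
  have y: "p_integral p y"
    using p_integral_pcong[OF assms(1,3)] assms(1) by simp
  have "pcong p 2 ((x + y) * (x + y) ^ k) ((x + y) * (x ^ k + of_nat k * x ^ (k - 1) * y))"
    using Suc assms y by (intro pcong_scale p_integral_add)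
  \<comment> \<open>The terms in \<open>y * y\<close> are split off, being divisible by
    \<open>p ^ 2\<close>. For \<open>k = 0\<close> the truncated exponent \<open>k - 1\<close> is
    multiplied by zero.\<close>
  also have "(x + y) * (x ^ k + of_nat k * x ^ (k - 1) * y) =
      (x ^ Suc k + of_nat (Suc k) * x ^ k * y) + of_nat k * x ^ (k - 1) * (y * y)"
    by (cases k) (simp_all add: algebra_simps)
  also have "pcong p 2 \<dots> ((x ^ Suc k + of_nat (Suc k) * x ^ k * y) + of_nat k * x ^ (k - 1) * 0)"
    using pcong_mult_zero[OF assms(1,3,3)] assms(1,2)
    by (intro pcong_add pcong_scale pcong_refl p_integral_mult p_integral_power p_integral_of_nat)
      (simp_all add: numeral_2_eq_2)
  finally show ?case
    using assms(1) by simp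
qed (use assms(1) in simp)

lemma recip_power_fermat:
  assumes "prime p" "\<not> p dvd x" "i + j = p - 1"
  shows "pcong p 1 ((1 / of_nat x) ^ i) (of_nat x ^ j)"
proof -
  have "of_nat x \<noteq> (0::rat)"
    using assms(2) by (metis dvd_0_right of_nat_eq_0_iff)
  then have "(1 / of_nat x) ^ i * of_nat x ^ (p - 1) = (of_nat x ^ j :: rat)"
    unfolding assms(3)[symmetric] by (simp add: power_add power_divide)
  moreover have "pcong p 1 ((1 / of_nat x) ^ i * of_nat x ^ (p - 1)) ((1 / of_nat x) ^ i * 1)"
    by (intro pcong_scale pcong_fermat p_integral_power p_integral_inverse assms)
  ultimately have "pcong p 1 (of_nat x ^ j) ((1 / of_nat x) ^ i)"
    by (simp only: mult_1_right)
  then show ?thesis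
    by (rule pcong_sym)
qed

lemma bij_betw_mult_mod:
  fixes p q :: nat
  assumes "prime p" "\<not> p dvd q"
  shows "bij_betw (\<lambda>m. q * m mod p) {0<..<p} {0<..<p}"
proof -
  have cop: "coprime q p"
    using prime_imp_coprime[OF assms] by (simp add: coprime_commute)
  have inj: "inj_on (\<lambda>m. q * m mod p) {0<..<p}"
  proof (rule inj_onI)
    fix x y assume xy: "x \<in> {0<..<p}" "y \<in> {0<..<p}" "q * x mod p = q * y mod p"
    then have "[x = y] (mod p)"
      using cong_mult_lcancel_nat[OF cop] by (simp add: cong_def)
    then show "x = y"
      using xy by (simp add: cong_def)
  qed
  have "(\<lambda>m. q * m mod p) ` {0<..<p} \<subseteq> {0<..<p}"
  proof (clarify)
    fix m assume m: "m \<in> {0<..<p}"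
    then have "\<not> p dvd q * m"
      using assms by (auto simp: prime_dvd_mult_iff dest: dvd_imp_le)
    then show "q * m mod p \<in> {0<..<p}"
      using m by (auto simp: dvd_eq_mod_eq_0)
  qed
  then show ?thesis
    using inj endo_inj_surj[OF _ _ inj] by (simp add: bij_betw_def)
qed

text \<open>Voronoi's sum for the Bernoulli index \<open>k = p - 3\<close> has the powers
  \<open>(q m) ^ (k - 1)\<close>; by Fermat these are inverse cubes modulo \<open>p\<close>. The
  inverse form also makes sense for \<open>p = 3\<close>.\<close>

definition voronoi_sum :: "nat \<Rightarrow> nat \<Rightarrow> rat" where
  "voronoi_sum p q = (\<Sum>m\<in>{0<..<p}. of_nat (q * m div p) * (1 / of_nat (q * m)) ^ 3)"

lemma pcong_cancel_p:
  assumes "prime p" "pcong p (a + 1) (of_nat p * x) (of_nat p * y)"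
  shows "pcong p a x y"
  using assms by (simp add: pcong_def prime_gt_0_nat flip: right_diff_distrib)

text \<open>Multiplication by \<open>q\<close> permutes the nonzero residues, so the
  \<open>k\<close>-th powers of \<open>q m mod p\<close> and of \<open>m\<close> have the same sum
  \<open>S\<close>. Expanding the former modulo \<open>p ^ 2\<close> gives
  \<open>(1 - q ^ k) S \<equiv> 3 p V\<close>, while \<open>S\<close> may be replaced by
  \<open>p * bernoulli k\<close>. One factor \<open>p\<close> cancels, and \<open>q ^ k\<close>
  becomes \<open>1 / q ^ 2\<close> because \<open>k + 2 = p - 1\<close>.\<close>

lemma voronoi_congruence:
  assumes p: "prime p" "odd p" and q: "\<not> p dvd q"
  shows "pcong p 1 (3 * voronoi_sum p q) ((1 - (1 / of_nat q) ^ 2) * bernoulli (p - 3))"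
proof -
  have "p > 2"
    using p prime_gt_1_nat[of p] by (cases "p = 2") auto
  then have p3: "p \<ge> 3"
    by simp
  define k where "k = p - 3"
  have nd: "\<not> p dvd q * m" if "m \<in> {0<..<p}" for m
    using that p q by (auto simp: prime_dvd_mult_iff dest: dvd_imp_le)
  have deriv: "pcong p 1 (of_nat k * of_nat x ^ (k - 1)) (- (3 * (1 / of_nat x) ^ 3))"
      if "\<not> p dvd x" for x
  proof -
    have int: "p_integral p ((1 / of_nat x) ^ 3)"
      using p that by (intro p_integral_power p_integral_inverse)
    have k3: "pcong p 1 (of_nat k) (- 3)"
      using p p3 by (simp add: pcong_def k_def of_nat_diff)
    show ?thesis
    proof (cases "p = 3")
      \<comment> \<open>Here \<open>k = 0\<close>: the left side is zero whatever the truncated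
        exponent \<open>k - 1\<close>, and the right side is a multiple of \<open>3\<close>.\<close>
      case True
      then have "pcong p 1 ((1 / of_nat x) ^ 3 * of_nat k) ((1 / of_nat x) ^ 3 * (- 3))"
        by (intro pcong_scale int k3 p)
      then show ?thesis
        using True by (simp add: k_def mult.commute)
    next
      case False
      then have "3 + (k - 1) = p - 1"
        using p3 p(2) by (cases "p = 4") (auto simp: k_def)
      from recip_power_fermat[OF p(1) that this]
      have "pcong p 1 (of_nat x ^ (k - 1)) ((1 / of_nat x) ^ 3)"
        by (rule pcong_sym)
      then have "pcong p 1 (of_nat k * of_nat x ^ (k - 1)) ((- 3) * (1 / of_nat x) ^ 3)"
        using p k3 int by (intro pcong_mult p_integral_of_nat)
      then show ?thesis
        by simp
    qed
  qed
  \<comment> \<open>Expand \<open>(q m mod p) ^ k = (q m - p (q m div p)) ^ k\<close> modulo \<open>p\<^sup>2\<close>.\<close>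
  have summand: "pcong p 2 (of_nat (q * m mod p) ^ k)
      (of_nat (q * m) ^ k + of_nat p * (3 * (of_nat (q * m div p) * (1 / of_nat (q * m)) ^ 3)))"
    if m: "m \<in> {0<..<p}" for m
  proof -
    define x f :: rat where "x = of_nat (q * m)" and "f = of_nat (q * m div p)"
    have "of_nat (q * m mod p) + of_nat p * f = x"
      unfolding x_def f_def by (metis mod_mult_div_eq of_nat_add of_nat_mult)
    then have "of_nat (q * m mod p) = x + - (of_nat p * f)"
      by simp
    moreover have "pcong p 2 ((x + - (of_nat p * f)) ^ k)
        (x ^ k + of_nat k * x ^ (k - 1) * - (of_nat p * f))"
      using p by (intro power_add_first_order)
          (auto simp: x_def f_def pcong_def intro!: p_integral_mult p_integral_minus)
    moreover have "pcong p 2 (x ^ k + of_nat k * x ^ (k - 1) * - (of_nat p * f))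
       (x ^ k + of_nat p * (3 * (f * (1 / x) ^ 3)))"
    proof -
      have "pcong p 1 (- f * (of_nat k * x ^ (k - 1))) (- f * - (3 * (1 / x) ^ 3))"
        unfolding x_def using p by (intro pcong_scale deriv nd m p_integral_minus)
            (simp_all add: f_def)
      from pcong_p_power[OF p(1) this, of 1]
      have "pcong p 2 (of_nat p * (- f * (of_nat k * x ^ (k - 1))))
          (of_nat p * (- f * - (3 * (1 / x) ^ 3)))"
        by (simp only: power_one_right one_add_one)
      then have "pcong p 2 (x ^ k + of_nat p * (- f * (of_nat k * x ^ (k - 1))))
          (x ^ k + of_nat p * (- f * - (3 * (1 / x) ^ 3)))"
        by (intro pcong_add pcong_refl p)
      then show ?thesis
        by (simp add: mult_ac)
    qed
    ultimately show ?thesis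
      unfolding x_def[symmetric] f_def[symmetric] using p(1) pcong_trans by simp
  qed
  define S :: rat where "S = (\<Sum>m\<in>{0<..<p}. of_nat m ^ k)"
  have "pcong p 2 (\<Sum>m\<in>{0<..<p}. of_nat (q * m mod p) ^ k)
     (\<Sum>m\<in>{0<..<p}. of_nat (q * m) ^ k
         + of_nat p * (3 * (of_nat (q * m div p) * (1 / of_nat (q * m)) ^ 3)))"
    by (intro pcong_sum p summand)
  moreover have "(\<Sum>m\<in>{0<..<p}. of_nat (q * m mod p) ^ k) = S"
    unfolding S_def
    using sum.reindex_bij_betw[OF bij_betw_mult_mod[OF p(1) q], of "\<lambda>r. of_nat r ^ k"] .
  moreover have "(\<Sum>m\<in>{0<..<p}. of_nat (q * m) ^ k
      + of_nat p * (3 * (of_nat (q * m div p) * (1 / of_nat (q * m)) ^ 3)))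
     = of_nat q ^ k * S + of_nat p * (3 * voronoi_sum p q)"
    by (simp only: sum.distrib sum_distrib_left S_def voronoi_sum_def of_nat_mult
        power_mult_distrib)
  ultimately have 1: "pcong p 2 S (of_nat q ^ k * S + of_nat p * (3 * voronoi_sum p q))"
    by simp
  have "pcong p 2 (\<Sum>j<p. of_nat j ^ k) (of_nat p * bernoulli k)"
    using p p3 by (intro power_sum_mod_square) (auto simp: k_def)
  then have "pcong p 2 ((1 - of_nat q ^ k) * (\<Sum>j<p. of_nat j ^ k))
      ((1 - of_nat q ^ k) * (of_nat p * bernoulli k))"
    using p by (intro pcong_scale p_integral_diff p_integral_power p_integral_1 p_integral_of_nat)
  \<comment> \<open>The sums differ by the term \<open>0 ^ k\<close>, which is \<open>1\<close> for
    \<open>k = 0\<close>; exactly then the factor \<open>1 - q ^ k\<close> vanishes.\<close>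
  moreover have "(1 - of_nat q ^ k) * (\<Sum>j<p. of_nat j ^ k) = (1 - of_nat q ^ k) * S"
  proof -
    have "{..<p} = insert 0 {0<..<p}"
      using p3 by auto
    then show ?thesis
      by (cases "k = 0") (simp_all add: S_def)
  qed
  ultimately have 2: "pcong p 2 ((1 - of_nat q ^ k) * S)
      ((1 - of_nat q ^ k) * (of_nat p * bernoulli k))"
    by simp
  have "pcong p 2 (of_nat p * (3 * voronoi_sum p q)) ((1 - of_nat q ^ k) * S)"
    using pcong_sym[OF 1[unfolded pcong_zero_iff[of p 2 S]]] pcong_sym[OF 1]
    by (subst pcong_zero_iff, subst (asm) (2) pcong_zero_iff) (simp add: algebra_simps)
  also note 2
  finally have "pcong p (1 + 1) (of_nat p * (3 * voronoi_sum p q))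
      (of_nat p * ((1 - of_nat q ^ k) * bernoulli k))"
    using p(1) by (simp add: mult_ac numeral_2_eq_2)
  then have "pcong p 1 (3 * voronoi_sum p q) ((1 - of_nat q ^ k) * bernoulli k)"
    by (rule pcong_cancel_p[OF p(1)])
  also have "pcong p 1 \<dots> ((1 - (1 / of_nat q) ^ 2) * bernoulli k)"
  proof -
    have "pcong p 1 ((1 / of_nat q) ^ 2) (of_nat q ^ k)"
      using p3 by (intro recip_power_fermat p q) (simp add: k_def)
    then have "pcong p 1 (bernoulli k * (1 - of_nat q ^ k))
        (bernoulli k * (1 - (1 / of_nat q) ^ 2))"
      using p p3 pcong_sym by (intro pcong_scale pcong_diff pcong_refl p_integral_bernoulli)
          (auto simp: k_def)
    then show ?thesis
      by (simp only: mult.commute)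
  qed
  finally show ?thesis
    using p(1) by (simp add: k_def)
qed

subsection \<open>Evaluation for two primes\<close>

lemma mem_coprime_pos_prime: "prime p \<Longrightarrow> x \<in> coprime_pos p \<longleftrightarrow> \<not> p dvd x"
  by (auto simp: coprime_pos_def coprime_commute[of x] intro: prime_imp_coprime gr0I
      dest: coprime_common_divisor not_prime_unit)

section \<open>Reciprocal sums over intervals and over pairs with given sum\<close>

lemma recip_periodic:
  assumes "prime p" "\<not> p dvd x"
  shows "pcong p 1 (1 / of_nat (x + p * b)) (1 / of_nat x)"
  using recip_translate[of p 1 p x b] assms by simp

lemma harmonic_below_prime:
  assumes "prime p" "odd p"
  shows "pcong p 1 (harmonic_below p) 0"
proof -
  have "p > 2"
    using assms prime_gt_1_nat[of p] by (cases "p = 2") auto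
  have "{..<p} = insert 0 {0<..<p}"
    using \<open>p > 2\<close> by auto
  then have "harmonic_below p = (\<Sum>j\<in>{0<..<p}. 1 / of_nat j)"
    by (simp add: harmonic_below_def)
  also have "pcong p 1 \<dots> (\<Sum>j\<in>{0<..<p}. of_nat j ^ (p - 2))"
    using assms by (intro pcong_sum pcong_recip_fermat) (auto dest: dvd_imp_le)
  also have "pcong p 1 \<dots> 0"
    using \<open>p > 2\<close> assms by (intro power_sum_mod) auto
  finally show ?thesis
    using assms by simp
qed

lemma pcong_sum_window:
  assumes "prime p" "\<And>j. pcong p a (g (j + p)) (g j)"
  shows "pcong p a (\<Sum>i<p. g (s + i)) (\<Sum>i<p. g i)"
proof (induction s)
  case (Suc s)
  have "(\<Sum>i<p. g (Suc s + i)) + g s = (\<Sum>i<Suc p. g (s + i))"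
    unfolding sum.lessThan_Suc_shift by simp
  then have "(\<Sum>i<p. g (Suc s + i)) = (\<Sum>i<p. g (s + i)) + (g (s + p) - g s)"
    by simp
  also have "pcong p a \<dots> ((\<Sum>i<p. g i) + (g s - g s))"
    using assms by (intro pcong_add pcong_diff pcong_refl Suc.IH)
  finally show ?case
    by simp
qed (use assms(1) in simp)

text \<open>The initial segment below \<open>r\<close> does not meet the excluded class and gives
  \<open>harmonic_below r\<close>. Each of the \<open>b\<close> full periods that follow is a
  complete sum of reciprocals, zero modulo \<open>p\<close>, without its term
  \<open>1 / r\<close>.\<close>

lemma sum_recip_avoiding_residue:
  assumes p: "prime p" "odd p" and r: "0 < r" "r < p"
  shows "pcong p 1 (\<Sum>j<r + p * b. if p dvd j \<or> j mod p = r then 0 else 1 / of_nat j)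
    (harmonic_below r - of_nat b / of_nat r)"
proof -
  define g :: "nat \<Rightarrow> rat" where "g j = (if p dvd j \<or> j mod p = r then 0 else 1 / of_nat j)" for j
  have nd: "\<not> p dvd r"
    using r by (auto dest: dvd_imp_le)
  have periodic: "pcong p 1 (g (j + p)) (g j)" for j
    using recip_periodic[OF p(1), of j 1] p(1) by (simp add: g_def)
  have period: "pcong p 1 (\<Sum>j<p. g j) (0 - 1 / of_nat r)"
  proof -
    have "g j = 1 / of_nat j - (if j = r then 1 / of_nat r else 0)" if "j < p" for j
      using that by (auto simp: g_def dest: dvd_imp_le)
    then have "(\<Sum>j<p. g j) = (\<Sum>j<p. 1 / of_nat j - (if j = r then 1 / of_nat r else 0))"
      by (intro sum.cong) auto
    also have "\<dots> = harmonic_below p - 1 / of_nat r"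
      using r by (simp add: sum_subtractf harmonic_below_def)
    also have "pcong p 1 \<dots> (0 - 1 / of_nat r)"
      by (intro pcong_diff pcong_refl harmonic_below_prime p)
    finally show ?thesis .
  qed
  have "pcong p 1 (\<Sum>j<r + p * b. g j) (harmonic_below r - of_nat b / of_nat r)"
  proof (induction b)
    case 0
    have "(\<Sum>j<r. g j) = harmonic_below r"
      unfolding harmonic_below_def using r by (intro sum.cong) (auto simp: g_def dest: dvd_imp_le)
    then show ?case
      using p(1) by simp
  next
    case (Suc b)
    have "(\<Sum>j<r + p * Suc b. g j) = (\<Sum>j<r + p * b. g j) + (\<Sum>i<p. g ((r + p * b) + i))"
    proof -
      have "(\<Sum>j<n + k. g j) = (\<Sum>j<n. g j) + (\<Sum>i<k. g (n + i))" for n k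
        by (induction k) (auto simp: add.assoc)
      from this[where n = "r + p * b" and k = p] show ?thesis
        by (simp only: mult_Suc_right add.assoc add.commute[of p "p * b"])
    qed
    also have "pcong p 1 \<dots> (harmonic_below r - of_nat b / of_nat r + (\<Sum>i<p. g i))"
      by (intro pcong_add p Suc.IH pcong_sum_window periodic)
    also have "pcong p 1 \<dots> (harmonic_below r - of_nat b / of_nat r + (0 - 1 / of_nat r))"
      by (intro pcong_add p pcong_refl period)
    also have "harmonic_below r - of_nat b / of_nat r + (0 - 1 / of_nat r)
        = harmonic_below r - of_nat (Suc b) / of_nat r"
      by (simp add: add_divide_distrib)
    finally show ?case
      using p(1) by simp
  qed
  then show ?thesis
    by (simp only: g_def)
qed

text \<open>First components of the pairs of sum \<open>l\<close> with both entries prime to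
  \<open>p\<close>; \<open>j = 0\<close> drops out because \<open>p\<close> divides
  \<open>0\<close>.\<close>

definition pair_indices :: "nat \<Rightarrow> nat \<Rightarrow> nat set" where
  "pair_indices p l = {j. j < l \<and> \<not> p dvd j \<and> \<not> p dvd (l - j)}"

text \<open>Partial fractions and the symmetry of \<open>j\<close> and \<open>l - j\<close> leave
  \<open>2 / l\<close> times the sum of \<open>1 / j\<close>. The condition on \<open>l - j\<close>
  excludes the residue class of \<open>l\<close>, so \<open>sum_recip_avoiding_residue\<close>
  applies with \<open>l div p\<close> full periods.\<close>

lemma pair_sum:
  assumes p: "prime p" "odd p" and l: "\<not> p dvd l"
  shows "pcong p 1 (\<Sum>j\<in>pair_indices p l. 1 / (of_nat j * of_nat (l - j)))
    (2 / of_nat l * (harmonic_below (l mod p) - of_nat (l div p) / of_nat l))"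
proof -
  define r where "r = l mod p"
  have r: "0 < r" "r < p"
    using l prime_gt_0_nat[OF p(1)] by (auto simp: r_def dvd_eq_mod_eq_0)
  have nd: "\<not> p dvd r"
    using r by (auto dest: dvd_imp_le)
  have l0: "l > 0"
    using l by (metis dvd_0_right gr0I)
  have lr: "l = r + p * (l div p)"
    by (simp add: r_def)
  have pos: "0 < j \<and> j < l" if "j \<in> pair_indices p l" for j
    using that by (auto simp: pair_indices_def intro!: gr0I)
  have swap: "(\<Sum>j\<in>pair_indices p l. 1 / of_nat (l - j))
      = (\<Sum>j\<in>pair_indices p l. 1 / of_nat j :: rat)"
  proof (rule sum.reindex_bij_witness[where i = "\<lambda>j. l - j" and j = "\<lambda>j. l - j"])
    fix j assume j: "j \<in> pair_indices p l"
    with pos[OF j] show "l - (l - j) = j" "l - j \<in> pair_indices p l"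
      by (simp_all add: pair_indices_def)
    then show "l - (l - j) = j" "l - j \<in> pair_indices p l" "1 / of_nat (l - j)
        = (1 / of_nat (l - j) :: rat)"
      by auto
  qed
  have "(\<Sum>j\<in>pair_indices p l. 1 / (of_nat j * of_nat (l - j)))
     = (\<Sum>j\<in>pair_indices p l. 1 / of_nat l * (1 / of_nat j + 1 / of_nat (l - j) :: rat))"
  proof (rule sum.cong[OF refl])
    fix j assume "j \<in> pair_indices p l"
    with pos have "0 < j" "j < l"
      by auto
    then obtain k where k: "l = j + k" "k > 0"
      by (metis less_imp_add_positive)
    have "1 / (x * y) = 1 / (x + y) * (1 / x + 1 / y)" if "x > 0" "y > 0" for x y :: rat
      using that by (simp add: divide_simps)
    from this[of "of_nat j" "of_nat k"]
    show "1 / (of_nat j * of_nat (l - j))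
        = 1 / of_nat l * (1 / of_nat j + 1 / of_nat (l - j) :: rat)"
      using k \<open>0 < j\<close> by simp
  qed
  also have "\<dots> = 2 / of_nat l * (\<Sum>j\<in>pair_indices p l. 1 / of_nat j)"
    by (simp only: sum_distrib_left[symmetric] sum.distrib swap) simp
  also have "(\<Sum>j\<in>pair_indices p l. 1 / of_nat j)
      = (\<Sum>j<l. if p dvd j \<or> j mod p = r then 0 else 1 / of_nat j :: rat)"
  proof -
    have "p dvd l - j \<longleftrightarrow> j mod p = r" if "j < l" for j
      using mod_eq_dvd_iff_nat[of j l p] that by (auto simp: r_def)
    then show ?thesis
      unfolding pair_indices_def by (intro sum.mono_neutral_cong_left) auto
  qed
  also have "pcong p 1 (2 / of_nat l * \<dots>)
      (2 / of_nat l * (harmonic_below r - of_nat (l div p) / of_nat r))"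
    using sum_recip_avoiding_residue[OF p r, of "l div p"] p l unfolding lr[symmetric]
    by (intro pcong_scale p_integral_divide p_integral_numeral)
  \<comment> \<open>The quotient term gets \<open>l\<close> in place of its residue, so that later
    it matches the summand of \<open>voronoi_sum\<close>.\<close>
  also have "pcong p 1 \<dots> (2 / of_nat l * (harmonic_below r - of_nat (l div p) / of_nat l))"
  proof -
    have "pcong p 1 (1 / of_nat l) (1 / of_nat r)"
      using recip_periodic[OF p(1) nd, of "l div p"] unfolding lr[symmetric] .
    then have "pcong p 1 (1 / of_nat r) (1 / of_nat l)"
      by (rule pcong_sym)
    then have "pcong p 1 (of_nat (l div p) * (1 / of_nat r)) (of_nat (l div p) * (1 / of_nat l))"
      by (rule pcong_scale[OF p(1) p_integral_of_nat[OF p(1)]])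
    then have "pcong p 1 (of_nat (l div p) / of_nat r) (of_nat (l div p) / of_nat l)"
      by simp
    then show ?thesis
      using p l by (intro pcong_scale pcong_diff pcong_refl p_integral_divide p_integral_numeral)
  qed
  finally show ?thesis
    using p(1) by (simp add: r_def)
qed

text \<open>The first entry is \<open>q u\<close> with \<open>0 < u < p\<close>. The parameter is
  \<open>m = p - u\<close>, since then the other two entries have sum \<open>q m\<close>.\<close>

lemma sum_recip3_first_divisible_eq:
  assumes p: "prime p" and q: "\<not> p dvd q"
  shows "sum recip3 {T \<in> triples (coprime_pos p) (p * q). q dvd fst T} =
    (\<Sum>m\<in>{0<..<p}. 1 / of_nat (p * q - q * m)
       * (\<Sum>j\<in>pair_indices p (q * m). 1 / (of_nat j * of_nat (q * m - j))))"
proof -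
  have q0: "q > 0"
    using q by (metis dvd_0_right gr0I)
  have mem: "x \<in> coprime_pos p \<longleftrightarrow> \<not> p dvd x" for x
    by (rule mem_coprime_pos_prime[OF p])
  have ndm: "\<not> p dvd m" if "m \<in> {0<..<p}" for m
    using that by (auto dest: dvd_imp_le)
  have nd: "\<not> p dvd q * m" if "m \<in> {0<..<p}" for m
    using ndm[OF that] p q by (simp add: prime_dvd_mult_iff)
  have less: "q * m < p * q" if "m \<in> {0<..<p}" for m
    using that q0 by (simp add: mult.commute)
  have "sum recip3 {T \<in> triples (coprime_pos p) (p * q). q dvd fst T} =
     (\<Sum>(m, j)\<in>(SIGMA m:{0<..<p}. pair_indices p (q * m)). recip3 (p * q - q * m, j, q * m - j))"
  proof (rule sum.reindex_bij_witness[where i = "\<lambda>(m, j). (p * q - q * m, j, q * m - j)"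
        and j = "\<lambda>(i, j, k). (p - i div q, j)"])
    fix T assume T: "T \<in> {T \<in> triples (coprime_pos p) (p * q). q dvd fst T}"
    then obtain u j k where u: "T = (q * u, j, k)"
      by (cases T) auto
    have ujk: "\<not> p dvd q * u" "\<not> p dvd j" "\<not> p dvd k" "q * u + j + k = p * q"
      using T by (auto simp: u triples_def mem)
    have "0 < j" "0 < k"
      using ujk(2,3) by (auto intro!: gr0I)
    have "0 < u"
      using ujk(1) by (auto intro!: gr0I)
    have "q * u < q * p"
      using ujk(4) \<open>0 < j\<close> mult.commute[of p q] by linarith
    then have "u < p"
      by simp
    have e: "q * (p - u) = j + k"
      using ujk(4) by (simp add: diff_mult_distrib2 mult.commute)
    have e2: "p * q - q * (p - u) = q * u"
      unfolding e using ujk(4) by simp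
    show "(case (case T of (i, j, k) \<Rightarrow> (p - i div q, j)) of (m, j) \<Rightarrow> (p * q - q * m, j, q * m - j))
        = T"
      using q0 e e2 by (simp add: u)
    then show "(case (case T of (i, j, k) \<Rightarrow> (p - i div q, j)) of (m, j) \<Rightarrow> recip3
        (p * q - q * m, j, q * m - j)) = recip3 T"
      by (simp add: case_prod_unfold)
    show "(case T of (i, j, k) \<Rightarrow> (p - i div q, j)) \<in> (SIGMA m:{0<..<p}. pair_indices p (q * m))"
      using q0 \<open>0 < u\<close> \<open>u < p\<close> \<open>0 < k\<close> e ujk by (simp add: u pair_indices_def)
  next
    fix v assume "v \<in> (SIGMA m:{0<..<p}. pair_indices p (q * m))"
    then obtain m j where v: "v = (m, j)" and m: "m \<in> {0<..<p}"
        and j: "j < q * m" "\<not> p dvd j" "\<not> p dvd q * m - j"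
      by (auto simp: pair_indices_def)
    have e: "p * q - q * m = q * (p - m)"
      by (simp add: diff_mult_distrib2 mult.commute)
    have "p - m \<in> {0<..<p}"
      using m by auto
    then have "\<not> p dvd q * (p - m)"
      by (rule nd)
    moreover have "q * (p - m) + j + (q * m - j) = p * q"
      using j(1) less[OF m] unfolding e[symmetric] by linarith
    ultimately show "(case v of (m, j) \<Rightarrow> (p * q - q * m, j, q * m - j)) \<in> {T \<in> triples
        (coprime_pos p) (p * q). q dvd fst T}"
      using j by (simp add: v e triples_def mem)
    show "(case (case v of (m, j) \<Rightarrow> (p * q - q * m, j, q * m - j)) of (i, j, k) \<Rightarrow> (p - i div q, j))
        = v"
      using q0 m by (simp add: v e)
  qed
  also have "\<dots> = (\<Sum>m\<in>{0<..<p}. \<Sum>j\<in>pair_indices p (q * m). recip3 (p * q - q * m, j, q * m - j))"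
    by (rule sum.Sigma[symmetric]) (auto simp: pair_indices_def)
  also have "\<dots> = (\<Sum>m\<in>{0<..<p}. 1 / of_nat (p * q - q * m) *
      (\<Sum>j\<in>pair_indices p (q * m). 1 / (of_nat j * of_nat (q * m - j))))"
  proof -
    have "recip3 (u, j, v) = 1 / of_nat u * (1 / (of_nat j * of_nat v))" for u j v
      by (simp add: recip3_def)
    then show ?thesis
      by (simp only: sum_distrib_left)
  qed
  finally show ?thesis .
qed

text \<open>With \<open>l = q m\<close> and \<open>r = l mod p\<close>, the factor
  \<open>1 / (p q - l)\<close> is \<open>- 1 / l\<close> modulo \<open>p\<close>, and
  \<open>pair_sum\<close> yields \<open>- 2 / r ^ 2\<close> times \<open>harmonic_below r\<close>
  plus \<open>2 (l div p) / l ^ 3\<close>. As \<open>m\<close> varies, \<open>r\<close> runs through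
  all nonzero residues, so the first part no longer depends on \<open>q\<close>.\<close>

lemma sum_recip3_first_divisible:
  assumes p: "prime p" "odd p" and q: "\<not> p dvd q"
  shows "pcong p 1 (sum recip3 {T \<in> triples (coprime_pos p) (p * q). q dvd fst T})
    (- 2 * bernoulli (p - 3) + 2 * voronoi_sum p q)"
proof -
  have nd: "\<not> p dvd q * m" if "m \<in> {0<..<p}" for m
    using that p q by (auto simp: prime_dvd_mult_iff dest: dvd_imp_le)
  have less: "q * m < p * q" if "m \<in> {0<..<p}" for m
    using that q by (auto simp: mult.commute intro!: gr0I)
  let ?L = "\<Sum>m\<in>{0<..<p}. 1 / of_nat (p * q - q * m)
       * (\<Sum>j\<in>pair_indices p (q * m). 1 / (of_nat j * of_nat (q * m - j)))"
  have "pcong p 1 ?L (\<Sum>m\<in>{0<..<p}.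
       - 2 * (1 / of_nat (q * m mod p) ^ 2 * harmonic_below (q * m mod p))
       + 2 * (of_nat (q * m div p) * (1 / of_nat (q * m)) ^ 3))"
  proof (intro pcong_sum p)
    fix m assume m: "m \<in> {0<..<p}"
    define l where "l = q * m"
    define r where "r = q * m mod p"
    have l: "\<not> p dvd l"
      unfolding l_def by (rule nd[OF m])
    then have r: "\<not> p dvd r"
      by (simp add: l_def r_def dvd_mod_iff)
    have "l < p * q"
      using less[OF m] by (simp add: l_def)
    have lr: "pcong p 1 (1 / of_nat l) (1 / of_nat r)"
      using recip_periodic[OF p(1) r, of "l div p"] by (simp add: l_def r_def)
    have inth: "p_integral p (harmonic_below r)"
    proof -
      have "r < p"
        using prime_gt_0_nat[OF p(1)] by (simp add: r_def)
      have "p_integral p (1 / of_nat j)" if "j < r" for j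
        using that \<open>r < p\<close> p by (cases "j = 0") (auto intro!: p_integral_inverse dest: dvd_imp_le)
      then show ?thesis
        unfolding harmonic_below_def using p by (intro p_integral_sum) auto
    qed
    have "pcong p 1 (1 / of_nat (p * q - l) *
        (\<Sum>j\<in>pair_indices p l. 1 / (of_nat j * of_nat (l - j))))
       ((- (1 / of_nat l)) * (2 / of_nat l *
           (harmonic_below (l mod p) - of_nat (l div p) / of_nat l)))"
    proof (rule pcong_mult[OF p(1)])
      show "pcong p 1 (1 / of_nat (p * q - l)) (- (1 / of_nat l))"
        using p l \<open>l < p * q\<close> by (intro recip_complement) auto
      then show "p_integral p (1 / of_nat (p * q - l))"
        using p_integral_pcong[OF p(1)] p_integral_minus p_integral_inverse[OF l] by blast
      show "p_integral p (2 / of_nat l * (harmonic_below (l mod p) - of_nat (l div p) / of_nat l))"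
        using p l inth unfolding r_def l_def
        by (intro p_integral_mult p_integral_divide p_integral_diff p_integral_numeral
            p_integral_of_nat)
      show "pcong p 1 (\<Sum>j\<in>pair_indices p l. 1 / (of_nat j * of_nat (l - j)))
          (2 / of_nat l * (harmonic_below (l mod p) - of_nat (l div p) / of_nat l))"
        by (rule pair_sum[OF p l])
    qed
    also have "\<dots> = - 2 * (harmonic_below r * (1 / of_nat l * (1 / of_nat l)))
        + 2 * (of_nat (l div p) * (1 / of_nat l) ^ 3)"
    proof -
      have "(- i) * (2 * i * (h - f * i)) = - 2 * (h * (i * i)) + 2 * (f * i ^ 3)" for i h f :: rat
        by (simp add: power3_eq_cube algebra_simps)
      from this[of "1 / of_nat l" "harmonic_below r" "of_nat (l div p)"] show ?thesis
        by (simp add: r_def l_def)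
    qed
    also have "pcong p 1 \<dots> (- 2 * (harmonic_below r * (1 / of_nat r * (1 / of_nat r)))
        + 2 * (of_nat (l div p) * (1 / of_nat l) ^ 3))"
      using p l r inth lr
      by (intro pcong_add pcong_scale pcong_mult pcong_refl p_integral_minus p_integral_numeral
          p_integral_inverse)
    also have "\<dots> = - 2 * (1 / of_nat r ^ 2 * harmonic_below r)
        + 2 * (of_nat (l div p) * (1 / of_nat l) ^ 3)"
      by (simp add: power2_eq_square)
    finally show "pcong p 1 (1 / of_nat (p * q - q * m) *
        (\<Sum>j\<in>pair_indices p (q * m). 1 / (of_nat j * of_nat (q * m - j))))
       (- 2 * (1 / of_nat (q * m mod p) ^ 2 * harmonic_below (q * m mod p))
       + 2 * (of_nat (q * m div p) * (1 / of_nat (q * m)) ^ 3))"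
      using p(1) unfolding l_def r_def by simp
  qed
  also have "\<dots> = - 2 * (\<Sum>m\<in>{0<..<p}. 1 / of_nat (q * m mod p) ^ 2 * harmonic_below (q * m mod p))
      + 2 * voronoi_sum p q"
  proof -
    have "(\<Sum>m\<in>A. - 2 * f m + 2 * g m) = - 2 * sum f A + 2 * sum g A" for f g :: "nat \<Rightarrow> rat" and A
      by (simp only: sum.distrib sum_distrib_left)
    then show ?thesis
      unfolding voronoi_sum_def .
  qed
  also have "(\<Sum>m\<in>{0<..<p}. 1 / of_nat (q * m mod p) ^ 2 * harmonic_below (q * m mod p))
      = (\<Sum>r\<in>{0<..<p}. 1 / of_nat r ^ 2 * harmonic_below r)"
    by (rule sum.reindex_bij_betw[OF bij_betw_mult_mod[OF p(1) q]])
  also have "pcong p 1 (- 2 * \<dots> + 2 * voronoi_sum p q)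
      (- 2 * bernoulli (p - 3) + 2 * voronoi_sum p q)"
    using p by (intro pcong_add pcong_scale pcong_refl harmonic_double_sum p_integral_minus
        p_integral_numeral)
  finally show ?thesis
    unfolding sum_recip3_first_divisible_eq[OF p(1) q] using p(1) by simp
qed

text \<open>The case \<open>q = 1\<close>: divisibility by \<open>1\<close> is no restriction, and
  all quotients \<open>m div p\<close> are zero.\<close>

lemma sum_recip3_prime:
  assumes "prime p" "odd p"
  shows "pcong p 1 (sum recip3 (triples (coprime_pos p) p)) (- 2 * bernoulli (p - 3))"
proof -
  have "voronoi_sum p 1 = 0"
    by (simp add: voronoi_sum_def)
  moreover have "\<not> p dvd 1"
    using assms(1) not_prime_unit by blast
  ultimately show ?thesis
    using sum_recip3_first_divisible[OF assms, of 1] by simp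
qed

lemma sum_recip3_two_primes:
  assumes p: "prime p" "odd p" and q: "prime q" "p \<noteq> q"
  shows "pcong p 1 (sum recip3 (triples (coprime_pos (p * q)) (p * q)))
    (2 * (2 - of_nat q) * (1 - 1 / of_nat q ^ 3) * bernoulli (p - 3))"
proof -
  define B where "B = bernoulli (p - 3)"
  define S where "S = triples (coprime_pos p) (p * q)"
  define S1 where "S1 = sum recip3 {T \<in> S. q dvd fst T}"
  define Zp where "Zp = sum recip3 (triples (coprime_pos p) p)"
  have npq: "\<not> p dvd q"
    using p q by (metis primes_dvd_imp_eq)
  have nqp: "\<not> q dvd p"
    using p q by (metis primes_dvd_imp_eq)
  have p3: "p \<ge> 3"
    using p prime_ge_2_nat[of p] by (cases "p = 2") auto
  have intB: "p_integral p B"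
    unfolding B_def using p p3 by (intro p_integral_bernoulli) auto
  have mem: "x \<in> coprime_pos p \<longleftrightarrow> \<not> p dvd x" for x
    by (rule mem_coprime_pos_prime[OF p(1)])
  have "coprime x q \<longleftrightarrow> \<not> q dvd x" if "x > 0" for x
    using mem_coprime_pos_prime[OF q(1), of x] that by (simp add: coprime_pos_def)
  then have mem2: "x \<in> coprime_pos (p * q) \<longleftrightarrow> x \<in> coprime_pos p \<and> \<not> q dvd x" for x
    by (auto simp: coprime_pos_def)
  have second: "sum recip3 {T \<in> S. q dvd fst (snd T)} = S1"
    unfolding S1_def
    by (rule sum.reindex_bij_witness[where i = "\<lambda>(i, j, k). (j, i, k)"
        and j = "\<lambda>(i, j, k). (j, i, k)"])
      (auto simp: S_def triples_def recip3_def)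
  have third: "sum recip3 {T \<in> S. q dvd snd (snd T)} = S1"
    unfolding S1_def
    by (rule sum.reindex_bij_witness[where i = "\<lambda>(i, j, k). (k, j, i)"
        and j = "\<lambda>(i, j, k). (k, j, i)"])
      (auto simp: S_def triples_def recip3_def)
  have all: "sum recip3 {T \<in> S. q dvd fst T \<and> q dvd fst (snd T) \<and> q dvd snd (snd T)}
      = 1 / of_nat q ^ 3 * Zp"
    unfolding Zp_def sum_distrib_left
  proof (rule sum.reindex_bij_witness[where i = "\<lambda>(i, j, k). (q * i, q * j, q * k)"
        and j = "\<lambda>(i, j, k). (i div q, j div q, k div q)"])
    fix T assume "T \<in> {T \<in> S. q dvd fst T \<and> q dvd fst (snd T) \<and> q dvd snd (snd T)}"
    then obtain x y z where T: "T = (q * x, q * y, q * z)" and S: "(q * x, q * y, q * z) \<in> S"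
      by (cases T) (auto elim!: dvdE)
    have q0: "q > 0"
      using q(1) by (simp add: prime_gt_0_nat)
    have "q * (x + y + z) = q * p"
      using S by (simp add: S_def triples_def algebra_simps)
    then have "x + y + z = p"
      using q0 by simp
    then show "(case T of (i, j, k) \<Rightarrow> (i div q, j div q, k div q)) \<in> triples (coprime_pos p) p"
      using S q0 by (auto simp: T S_def triples_def mem)
    show "(case (case T of (i, j, k) \<Rightarrow> (i div q, j div q, k div q)) of (i, j, k) \<Rightarrow>
        (q * i, q * j, q * k)) = T"
      using q0 by (simp add: T)
    show "1 / of_nat q ^ 3 * recip3 (case T of (i, j, k) \<Rightarrow> (i div q, j div q, k div q)) = recip3 T"
      using q0 by (simp add: T recip3_def power3_eq_cube mult_ac)
  next
    fix T assume T: "T \<in> triples (coprime_pos p) p"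
    then obtain x y z where xyz: "T = (x, y, z)" "x + y + z = p" "\<not> p dvd x" "\<not> p dvd y" "\<not> p dvd z"
      by (auto simp: triples_def mem)
    then show "(case T of (i, j, k) \<Rightarrow> (q * i, q * j, q * k))
        \<in> {T \<in> S. q dvd fst T \<and> q dvd fst (snd T) \<and> q dvd snd (snd T)}"
      using p npq by (auto simp: S_def triples_def mem prime_dvd_mult_iff algebra_simps)
    show "(case (case T of (i, j, k) \<Rightarrow> (q * i, q * j, q * k)) of (i, j, k) \<Rightarrow>
        (i div q, j div q, k div q)) = T"
      using q(1) by (simp add: xyz prime_gt_0_nat)
  qed
  have "sum recip3 (triples (coprime_pos (p * q)) (p * q)) =
      sum recip3 {T \<in> S. \<not> q dvd fst T \<and> \<not> q dvd fst (snd T) \<and> \<not> q dvd snd (snd T)}"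
    by (rule sum.cong) (auto simp: S_def triples_def mem2)
  also have "\<dots> = (\<Sum>T\<in>S. of_bool (\<not> q dvd fst T \<and> \<not> q dvd fst (snd T) \<and> \<not> q dvd snd (snd T))
      * recip3 T)"
    unfolding S_def by (rule sum_of_bool_mult[OF finite_triples, symmetric])
  also have "\<dots> = (\<Sum>T\<in>S. recip3 T - of_bool (q dvd fst T) * recip3 T
      - of_bool (q dvd fst (snd T)) * recip3 T
      - of_bool (q dvd snd (snd T)) * recip3 T
      + 2 * (of_bool (q dvd fst T \<and> q dvd fst (snd T) \<and> q dvd snd (snd T)) * recip3 T))"
  proof (rule sum.cong[OF refl])
    fix T assume "T \<in> S"
    then obtain i j k where T: "T = (i, j, k)" "i + j + k = p * q"
      by (auto simp: S_def triples_def)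
    have "q dvd i + j + k"
      unfolding T(2) by simp
    \<comment> \<open>The number of entries divisible by \<open>q\<close> is thus \<open>0\<close>,
      \<open>1\<close> or \<open>3\<close>. Subtracting once per position gives \<open>1 - 3\<close>
      in the last case, which the coefficient \<open>2\<close> corrects to zero.\<close>
    then have "(q dvd i \<longrightarrow> q dvd j \<longrightarrow> q dvd k) \<and> (q dvd i \<longrightarrow> q dvd k \<longrightarrow> q dvd j)
        \<and> (q dvd j \<longrightarrow> q dvd k \<longrightarrow> q dvd i)"
      by (metis add.assoc dvd_add_left_iff dvd_add_right_iff)
    then show "of_bool (\<not> q dvd fst T \<and> \<not> q dvd fst (snd T) \<and> \<not> q dvd snd (snd T)) * recip3 T
      = recip3 T - of_bool (q dvd fst T) * recip3 T - of_bool (q dvd fst (snd T)) * recip3 T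
      - of_bool (q dvd snd (snd T)) * recip3 T
      + 2 * (of_bool (q dvd fst T \<and> q dvd fst (snd T) \<and> q dvd snd (snd T)) * recip3 T)"
      unfolding T(1) fst_conv snd_conv
      by (cases "q dvd i"; cases "q dvd j"; cases "q dvd k") simp_all
  qed
  also have "\<dots> = sum recip3 S - 3 * S1 + 2 * (1 / of_nat q ^ 3 * Zp)"
    unfolding sum.distrib sum_subtractf sum_distrib_left[symmetric] S_def
        sum_of_bool_mult[OF finite_triples]
    unfolding S_def[symmetric] second third all unfolding S1_def[symmetric] by simp
  also have "pcong p 1 \<dots> (of_nat q * (- 2 * B)
      - (- 6 * B + 2 * ((1 - (1 / of_nat q) ^ 2) * B)) + 2 * (1 / of_nat q ^ 3 * (- 2 * B)))"
  proof (intro pcong_add pcong_diff p)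
    have Zp: "pcong p 1 Zp (- 2 * B)"
      unfolding Zp_def B_def by (rule sum_recip3_prime[OF p])
    \<comment> \<open>Total \<open>p q\<close> is taken as \<open>q\<close> times the total
      \<open>p\<close>, with coprimality to \<open>p\<close> only.\<close>
    have "pcong p 1 (sum recip3 S) (of_nat q * Zp)"
      unfolding S_def Zp_def using sum_recip3_multiple[of p 1 p p q] p
      by (simp add: prime_gt_0_nat mult.commute)
    also have "pcong p 1 \<dots> (of_nat q * (- 2 * B))"
      by (rule pcong_scale[OF p(1) p_integral_of_nat[OF p(1)] Zp])
    finally show "pcong p 1 (sum recip3 S) (of_nat q * (- 2 * B))"
      using p(1) by simp
    have "pcong p 1 S1 (- 2 * B + 2 * voronoi_sum p q)"
      unfolding S1_def S_def B_def by (rule sum_recip3_first_divisible[OF p npq])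
    then have "pcong p 1 (3 * S1) (3 * (- 2 * B + 2 * voronoi_sum p q))"
      by (rule pcong_scale[OF p(1) p_integral_numeral[OF p(1)]])
    \<comment> \<open>Keeping the factor \<open>3\<close> lets Voronoi's congruence be inserted
      without dividing by \<open>3\<close>.\<close>
    also have "\<dots> = - 6 * B + 2 * (3 * voronoi_sum p q)"
      by simp
    also have "pcong p 1 \<dots> (- 6 * B + 2 * ((1 - (1 / of_nat q) ^ 2) * B))"
      using voronoi_congruence[OF p npq] p unfolding B_def[symmetric]
      by (intro pcong_add pcong_refl pcong_scale[OF p(1) p_integral_numeral[OF p(1)]])
    finally show "pcong p 1 (3 * S1) (- 6 * B + 2 * ((1 - (1 / of_nat q) ^ 2) * B))"
      using p(1) by simp
    have "p_integral p (1 / of_nat q ^ 3)"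
      using p_integral_power[OF p(1) p_integral_inverse[OF npq], of 3] by (simp add: power_divide)
    then have "pcong p 1 (1 / of_nat q ^ 3 * Zp) (1 / of_nat q ^ 3 * (- 2 * B))"
      using Zp by (rule pcong_scale[OF p(1)])
    then show "pcong p 1 (2 * (1 / of_nat q ^ 3 * Zp)) (2 * (1 / of_nat q ^ 3 * (- 2 * B)))"
      by (rule pcong_scale[OF p(1) p_integral_numeral[OF p(1)]])
  qed
  also have "of_nat q * (- 2 * B) - (- 6 * B + 2 * ((1 - (1 / of_nat q) ^ 2) * B))
      + 2 * (1 / of_nat q ^ 3 * (- 2 * B))
      = 2 * (2 - of_nat q) * (1 - 1 / of_nat q ^ 3) * B"
  proof -
    have "of_nat q \<noteq> (0::rat)"
      using q(1) by (simp add: prime_gt_0_nat)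
    then show ?thesis
      by (simp add: field_simps power2_eq_square power3_eq_cube)
  qed
  finally show ?thesis
    using p(1) by (simp add: B_def)
qed

text \<open>Each further factor \<open>p\<close> in the total raises the valid modulus by one power,
  and the induction hypothesis, multiplied by \<open>p\<close>, keeps pace.\<close>

lemma sum_recip3_prime_power:
  assumes p: "prime p" "odd p" "p dvd m" "m dvd p * N" "N > 0"
  shows "pcong p (k + 1) (sum recip3 (triples (coprime_pos m) (p ^ (k + 1) * N)))
    (of_nat p ^ k * sum recip3 (triples (coprime_pos m) (p * N)))"
proof (induction k)
  case (Suc k)
  have "m dvd p ^ (k + 1) * N"
    using p(4) by (metis Suc_eq_plus1 dvd_mult2 mult.assoc mult.commute power_Suc)
  then have "pcong p (k + 1 + 1) (sum recip3 (triples (coprime_pos m) (p * (p ^ (k + 1) * N))))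
      (of_nat p * sum recip3 (triples (coprime_pos m) (p ^ (k + 1) * N)))"
    using p by (intro sum_recip3_prime_multiple) (auto simp: prime_gt_0_nat)
  also have "pcong p (k + 1 + 1) (of_nat p * sum recip3 (triples (coprime_pos m) (p ^ (k + 1) * N)))
      (of_nat p * (of_nat p ^ k * sum recip3 (triples (coprime_pos m) (p * N))))"
    using pcong_p_power[OF p(1) Suc.IH, of 1] by (simp only: power_one_right)
  finally show ?case
    using p(1) by (simp add: mult.assoc)
qed (use p in simp)

theorem theorem3:
  fixes p q \<alpha> \<beta> :: nat
  assumes "prime p" and "prime q" and "odd p" and "odd q" and "p \<noteq> q"
    and "\<alpha> \<ge> 1" and "\<beta> \<ge> 1"
  shows "rat_cong p \<alpha>
           (\<Sum>(i, j, k) \<in> {(i, j, k). i \<in> coprime_pos (p * q) \<and> j \<in> coprime_pos (p * q)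
                \<and> k \<in> coprime_pos (p * q) \<and> odd i \<and> odd j \<and> odd k
                \<and> i + j + k = p ^ \<alpha> * q ^ \<beta>}. 1 / (of_nat i * of_nat j * of_nat k))
           (7 / 16 * Z (p ^ \<alpha> * q ^ \<beta>))
       \<and> rat_cong p \<alpha>
           (7 / 16 * Z (p ^ \<alpha> * q ^ \<beta>))
           (7 / 8 * (2 - of_nat q) * (1 - 1 / of_nat q ^ 3)
              * of_nat p ^ (\<alpha> - 1) * of_nat q ^ (\<beta> - 1) * bernoulli (p - 3))"
proof -
  note p = \<open>prime p\<close> and q = \<open>prime q\<close>
  define a b where "a = \<alpha> - 1" and "b = \<beta> - 1"
  have ab: "\<alpha> = a + 1" "\<beta> = b + 1"
    using assms by (simp_all add: a_def b_def)
  have pos: "p > 0" "q > 0"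
    using p q by (simp_all add: prime_gt_0_nat)
  let ?S = "\<lambda>n. sum recip3 (triples (coprime_pos (p * q)) n)"
  have "coprime_pos (p ^ \<alpha> * q ^ \<beta>) = coprime_pos (p * q)"
    using assms by (simp add: coprime_pos_def)
  then have Z: "Z (p ^ \<alpha> * q ^ \<beta>) = ?S (p ^ \<alpha> * q ^ \<beta>)"
    by (simp add: Z_def triples_def recip3_def)
  have dvd: "p * q dvd p ^ \<alpha> * q ^ \<beta>"
    unfolding ab by (intro mult_dvd_mono) simp_all
  have first: "pcong p \<alpha> (\<Sum>(i, j, k) \<in> {(i, j, k). i \<in> coprime_pos (p * q) \<and> j \<in> coprime_pos (p * q)
                \<and> k \<in> coprime_pos (p * q) \<and> odd i \<and> odd j \<and> odd k
                \<and> i + j + k = p ^ \<alpha> * q ^ \<beta>}. 1 / (of_nat i * of_nat j * of_nat k))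
           (7 / 16 * Z (p ^ \<alpha> * q ^ \<beta>))"
    unfolding Z using assms dvd by (intro sum_recip3_all_odd) auto
  \<comment> \<open>\<open>16\<close> is written as a power of \<open>2\<close> to reduce its
    invertibility modulo \<open>p\<close> to \<open>p\<close> being odd.\<close>
  have "\<not> p dvd 2 ^ 4"
    using prime_dvd_power[OF p] odd_prime_not_dvd_2[OF p \<open>odd p\<close>] by blast
  then have "p_integral p (7 / of_nat (2 ^ 4))"
    by (intro p_integral_divide p_integral_numeral p)
  then have int: "p_integral p (7 / 16)"
    by simp
  have "pcong p \<alpha> (?S (p ^ \<alpha> * q ^ \<beta>)) (of_nat p ^ a * ?S (p * q ^ \<beta>))"
    unfolding ab(1) using assms pos
    by (intro sum_recip3_prime_power) (auto simp: ab intro!: mult_dvd_mono)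
  \<comment> \<open>The factor \<open>p ^ a\<close> with \<open>a = \<alpha> - 1\<close> raises a
    congruence modulo \<open>p\<close> to one modulo \<open>p ^ \<alpha>\<close>, so the remaining
    sum is needed only modulo \<open>p\<close>.\<close>
  also have "pcong p \<alpha> (of_nat p ^ a * ?S (p * q ^ \<beta>))
      (of_nat p ^ a * (of_nat q ^ b *
          (2 * (2 - of_nat q) * (1 - 1 / of_nat q ^ 3) * bernoulli (p - 3))))"
  proof -
    have "pcong p 1 (?S (q ^ b * (p * q))) (of_nat (q ^ b) * ?S (p * q))"
      using p pos by (intro sum_recip3_multiple) auto
    also have "pcong p 1 (of_nat (q ^ b) * ?S (p * q))
        (of_nat (q ^ b) * (2 * (2 - of_nat q) * (1 - 1 / of_nat q ^ 3) * bernoulli (p - 3)))"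
      using assms by (intro pcong_scale p_integral_of_nat sum_recip3_two_primes)
    finally have "pcong p 1 (?S (p * q ^ \<beta>))
        (of_nat q ^ b * (2 * (2 - of_nat q) * (1 - 1 / of_nat q ^ 3) * bernoulli (p - 3)))"
      using p by (simp add: ab mult_ac)
    from pcong_p_power[OF p this, of a] show ?thesis
      by (simp add: ab add.commute)
  qed
  finally have "pcong p \<alpha> (?S (p ^ \<alpha> * q ^ \<beta>))
      (of_nat p ^ a * (of_nat q ^ b *
          (2 * (2 - of_nat q) * (1 - 1 / of_nat q ^ 3) * bernoulli (p - 3))))"
    using p by simp
  moreover have "7 / 16 * (u * (v * (2 * s * t * w))) = 7 / 8 * s * t * u * v * w"
      for s t u v w :: rat
    by simp
  ultimately have "pcong p \<alpha> (7 / 16 * Z (p ^ \<alpha> * q ^ \<beta>))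
      (7 / 8 * (2 - of_nat q) * (1 - 1 / of_nat q ^ 3)
              * of_nat p ^ (\<alpha> - 1) * of_nat q ^ (\<beta> - 1) * bernoulli (p - 3))"
    unfolding Z a_def b_def using pcong_scale[OF p int] by metis
  with first show ?thesis
    using rat_congI[OF p] by blast
qed

end
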